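(* For $X\in\mathsf{cSet}$ and vertices $x_0,x_1\colon\Box^0\to X$, there are natural isomorphisms of simplicial sets: (1) $\int_{L,0}\mathrm{Map}^L_X(x_0,x_1)\cong\mathrm{Hom}^R_{\int_{L,0}X}(x_1,x_0)$; (2) $\int_{L,1}\mathrm{Map}^L_X(x_0,x_1)\cong\mathrm{Hom}^R_{\int_{L,1}X}(x_0,x_1)$; (3) $\int_{R,0}\mathrm{Map}^R_X(x_0,x_1)\cong\mathrm{Hom}^R_{\int_{R,0}X}(x_1,x_0)$; (4) $\int_{R,1}\mathrm{Map}^R_X(x_0,x_1)\cong\mathrm{Hom}^R_{\int_{R,1}X}(x_0,x_1)$.
   Context: Cubical sets. $\Box$ is the category whose objects are the posets $[1]^n=\{0\le 1\}^n$, $n\ge 0$, and whose morphisms are generated (inside posets) under composition by: faces $\partial_{i,\varepsilon}\colon[1]^{n-1}\to[1]^n$ (insert $\varepsilon\in\{0,1\}$ as $i$-th coordinate); degeneracies $\sigma_i\colon[1]^n\to[1]^{n-1}$ (omit the $i$-th coordinate); negative connections $\gamma_{i,0}\colon[1]^n\to[1]^{n-1}$ (replace $x_i,x_{i+1}$ by their maximum) and positive connections $\gamma_{i,1}$ (replace them by their minimum). $\mathsf{cSet}=\mathsf{Set}^{\Box^{\mathrm{op}}}$; $\Box^n$ is the representable at $[1]^n$; operators act on the right. The geometric product $\otimes$ is the monoidal product on $\mathsf{cSet}$ preserving colimits in each variable with $\Box^m\otimes\Box^n=\Box^{m+n}$. Cones and $Q_{W,\varepsilon}$. For $\varepsilon\in\{0,1\}$,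 $C_{L,\varepsilon}X$ is the pushout of $\Box^0\leftarrow X\xrightarrow{\partial_{1,\varepsilon}\otimes X}\Box^1\otimes X$ and $C_{R,\varepsilon}X$ is the pushout of $\Box^0\leftarrow X\xrightarrow{X\otimes\partial_{1,\varepsilon}}X\otimes\Box^1$. For $W\in\{L,R\}$ put $Q^n_{W,\varepsilon}=C_{W,\varepsilon}^{n+1}\varnothing\cong C^n_{W,\varepsilon}\Box^0$, a quotient of $\Box^n$. These form cosimplicial objects $Q_{W,\varepsilon}\colon\Delta\to\mathsf{cSet}$ with structure maps induced on quotients as follows ($0$-th face, $j$-th face for $1\le j\le n$ from level $n-1$ to level $n$; $0$-th degeneracy, $j$-th degeneracy for $1\le j\le n-1$ from level $n$ to level $n-1$): $(L,1)$: $\partial_{n,1}$, $\partial_{n-j+1,0}$; $\sigma_n$, $\gamma_{n-j,0}$. $(L,0)$: $\partial_{n,0}$, $\partial_{n-j+1,1}$; $\sigma_n$, $\gamma_{n-j,1}$. $(R,1)$: $\partial_{1,1}$, $\partial_{j,0}$; $\sigma_1$, $\gamma_{j,0}$. $(R,0)$: $\partial_{1,0}$, $\partial_{j,1}$; $\sigma_1$, $\gamma_{j,1}$. $Q_{W,\varepsilon}\colon\mathsf{sSet}\to\mathsf{cSet}$ also denotes the colimit-preserving extension, and $\int_{W,\varepsilon}$ its right adjoint, $(\int_{W,\varepsilon}X)_n=\mathsf{cSet}(Q^n_{W,\varepsilon},X)$. Since $Q^0_{W,\varepsilon}=\Box^0$, vertices of $X$ and of $\int_{W,\varepsilon}X$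 are identified. Cubical mapping spaces. $\mathrm{Map}^R_X(x_0,x_1)$ is the cubical set whose $n$-cubes are the $(n+1)$-cubes $s$ of $X$ with $s\partial_{n+1,\varepsilon}=x_\varepsilon$ for $\varepsilon=0,1$, operators of $X$ acting on the first $n$ coordinates. $\mathrm{Map}^L_X(x_0,x_1)$ has as $n$-cubes the $(n+1)$-cubes $s$ of $X$ with $s\partial_{1,\varepsilon}=x_\varepsilon$ for $\varepsilon=0,1$, operators of $X$ acting on the last $n$ coordinates. (Here $x_\varepsilon$ also denotes the degenerate cube on it.) Simplicial right mapping space. For a simplicial set $Y$ with vertices $y_0,y_1$, $\mathrm{Hom}^R_Y(y_0,y_1)_n=\{s\colon\Delta^{n+1}\to Y\mid s\partial_{n+1}=y_0,\ s|_{\Delta^{\{n+1\}}}=y_1\}$, where $y_0$ also denotes the constant $n$-simplex, and the $i$-th face (degeneracy) map of $\mathrm{Hom}^R_Y(y_0,y_1)$ is the $i$-th face (degeneracy) map of $Y$. *)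

theory Defs
  imports "HOL-Library.FuncSet"
begin

section \<open>The category of cubes\<close>

text \<open>
  The poset \<open>[1]^n\<close> is the set \<open>pts n\<close> of bit lists of length \<open>n\<close>, ordered coordinatewise; its first
  coordinate is the head of the list.  A sign \<open>\<epsilon>\<close> in \<open>{0, 1}\<close> is a \<open>bool\<close>: \<open>False\<close> is 0 and
  \<open>True\<close> is 1.  A morphism \<open>[1]^m \<rightarrow> [1]^n\<close> is a function on \<open>pts m\<close> that is \<open>undefined\<close> elsewhere.
  Coordinate indices \<open>i\<close> start at 1.
\<close>

type_synonym oper = "bool list \<Rightarrow> bool list"

definition pts :: "nat \<Rightarrow> bool list set" where
  "pts n = {v. length v = n}"

definition idm :: "nat \<Rightarrow> oper" where
  "idm n = (\<lambda>v\<in>pts n. v)"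

text \<open>\<open>face n i \<epsilon> : [1]^n \<rightarrow> [1]^(n+1)\<close> for \<open>1 \<le> i \<le> n + 1\<close>.\<close>

definition face :: "nat \<Rightarrow> nat \<Rightarrow> bool \<Rightarrow> oper" where
  "face n i e = (\<lambda>v\<in>pts n. take (i - 1) v @ e # drop (i - 1) v)"

text \<open>\<open>degen n i : [1]^(n+1) \<rightarrow> [1]^n\<close> for \<open>1 \<le> i \<le> n + 1\<close>.\<close>

definition degen :: "nat \<Rightarrow> nat \<Rightarrow> oper" where
  "degen n i = (\<lambda>v\<in>pts (Suc n). take (i - 1) v @ drop i v)"

text \<open>\<open>conn n i \<epsilon> : [1]^(n+1) \<rightarrow> [1]^n\<close> for \<open>1 \<le> i \<le> n\<close>: maximum for \<open>\<epsilon> = 0\<close>, minimum for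
  \<open>\<epsilon> = 1\<close>.\<close>

definition conn :: "nat \<Rightarrow> nat \<Rightarrow> bool \<Rightarrow> oper" where
  "conn n i e = (\<lambda>v\<in>pts (Suc n).
     take (i - 1) v @ (if e then min (v ! (i - 1)) (v ! i) else max (v ! (i - 1)) (v ! i))
       # drop (Suc i) v)"

inductive box :: "nat \<Rightarrow> nat \<Rightarrow> oper \<Rightarrow> bool" where
  idm: "box n n (idm n)"
| face: "1 \<le> i \<Longrightarrow> i \<le> Suc n \<Longrightarrow> box n (Suc n) (face n i e)"
| degen: "1 \<le> i \<Longrightarrow> i \<le> Suc n \<Longrightarrow> box (Suc n) n (degen n i)"
| conn: "1 \<le> i \<Longrightarrow> i \<le> n \<Longrightarrow> box (Suc n) n (conn n i e)"
| comp: "box m n f \<Longrightarrow> box n p g \<Longrightarrow> box m p (compose (pts m) g f)"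

text \<open>The unique map \<open>[1]^n \<rightarrow> [1]^0\<close>.\<close>

definition terminal :: "nat \<Rightarrow> oper" where
  "terminal n = (\<lambda>v\<in>pts n. [])"

text \<open>The monoidal product of \<open>f : [1]^m \<rightarrow> [1]^m'\<close> and \<open>g : [1]^n \<rightarrow> [1]^n'\<close>.\<close>

definition prod_op :: "nat \<Rightarrow> nat \<Rightarrow> oper \<Rightarrow> oper \<Rightarrow> oper" where
  "prod_op m n f g = (\<lambda>v\<in>pts (m + n). f (take m v) @ g (drop m v))"


section \<open>Cubical sets\<close>

text \<open>\<open>act X m n f : X_n \<rightarrow> X_m\<close> is the right action of \<open>f : [1]^m \<rightarrow> [1]^n\<close>.\<close>

record 'a cset =
  cells :: "nat \<Rightarrow> 'a set"
  act :: "nat \<Rightarrow> nat \<Rightarrow> oper \<Rightarrow> 'a \<Rightarrow> 'a"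

definition cubical_set :: "'a cset \<Rightarrow> bool" where
  "cubical_set X \<longleftrightarrow>
     (\<forall>m n f. box m n f \<longrightarrow> act X m n f \<in> cells X n \<rightarrow> cells X m) \<and>
     (\<forall>n. \<forall>s\<in>cells X n. act X n n (idm n) s = s) \<and>
     (\<forall>m n p f g. box m n f \<longrightarrow> box n p g \<longrightarrow>
        (\<forall>s\<in>cells X p. act X m p (compose (pts m) g f) s = act X m n f (act X n p g s)))"

text \<open>Components are \<open>undefined\<close> outside the cells of the source, so that equality of
  cubical maps is equality of functions.\<close>

definition cset_hom :: "'a cset \<Rightarrow> 'b cset \<Rightarrow> (nat \<Rightarrow> 'a \<Rightarrow> 'b) set" where
  "cset_hom X Y = {\<phi>.
     (\<forall>n. \<phi> n \<in> cells X n \<rightarrow>\<^sub>E cells Y n) \<and>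
     (\<forall>m n f. box m n f \<longrightarrow> (\<forall>s\<in>cells X n. \<phi> m (act X m n f s) = act Y m n f (\<phi> n s)))}"

definition hom_comp :: "'a cset \<Rightarrow> (nat \<Rightarrow> 'b \<Rightarrow> 'c) \<Rightarrow> (nat \<Rightarrow> 'a \<Rightarrow> 'b) \<Rightarrow> nat \<Rightarrow> 'a \<Rightarrow> 'c" where
  "hom_comp X \<psi> \<phi> = (\<lambda>n. compose (cells X n) (\<psi> n) (\<phi> n))"

text \<open>The degenerate \<open>n\<close>-cube on a vertex.\<close>

definition const_cube :: "'a cset \<Rightarrow> nat \<Rightarrow> 'a \<Rightarrow> 'a" where
  "const_cube X n x = act X n 0 (terminal n) x"


section \<open>Geometric product and cones\<close>

text \<open>
  Cones have to be iterated, which in HOL requires one type that is closed under the construction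
  of geometric products and pushouts.  The type \<open>cell\<close> contains the cubes of representables,
  generators of geometric products and the two summands of a pushout.  Quotients are formed by
  choosing one representative in every equivalence class.
\<close>

datatype cell =
    Cube oper
  | Tens nat nat cell cell oper
  | PInl cell
  | PInr cell

text \<open>The chosen representative of the class of \<open>x\<close> for the equivalence relation generated by
  \<open>r\<close>.\<close>

definition class_rep :: "('a \<times> 'a) set \<Rightarrow> 'a \<Rightarrow> 'a" where
  "class_rep r x = (SOME y. (x, y) \<in> (r \<union> r\<inverse>)\<^sup>*)"

definition empty_cset :: "cell cset" where
  "empty_cset = \<lparr>cells = (\<lambda>n. {}), act = (\<lambda>m n f s. s)\<rparr>"

definition cube_op :: "nat \<Rightarrow> oper \<Rightarrow> cell \<Rightarrow> cell" where
  "cube_op m f s = (case s of Cube g \<Rightarrow> Cube (compose (pts m) g f) | _ \<Rightarrow> s)"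

definition cube :: "nat \<Rightarrow> cell cset" where
  "cube N = \<lparr>cells = (\<lambda>n. {Cube f |f. box n N f}), act = (\<lambda>m n f s. cube_op m f s)\<rparr>"

text \<open>
  The geometric product extends \<open>[1]^m \<otimes> [1]^n = [1]^(m+n)\<close> to a monoidal product preserving
  colimits in each variable, so it is the Day convolution
  \<open>(X \<otimes> Y)_k = \<integral>^(m,n) X_m \<times> Y_n \<times> Box([1]^k, [1]^(m+n))\<close>.
  The element \<open>Tens m n x y f\<close> stands for \<open>(x \<otimes> y) f\<close>, and the coend identifies
  \<open>(x a \<otimes> y b) f\<close> with \<open>(x \<otimes> y) (a \<otimes> b) f\<close>.
\<close>

definition tensor_gen :: "cell cset \<Rightarrow> cell cset \<Rightarrow> nat \<Rightarrow> cell set" where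
  "tensor_gen X Y k =
     {Tens m n x y f |m n x y f. x \<in> cells X m \<and> y \<in> cells Y n \<and> box k (m + n) f}"

definition tensor_rel :: "cell cset \<Rightarrow> cell cset \<Rightarrow> nat \<Rightarrow> (cell \<times> cell) set" where
  "tensor_rel X Y k =
     {(Tens m n (act X m m' a x) (act Y n n' b y) f,
       Tens m' n' x y (compose (pts k) (prod_op m n a b) f)) |m n m' n' a b x y f.
        box m m' a \<and> box n n' b \<and> x \<in> cells X m' \<and> y \<in> cells Y n' \<and> box k (m + n) f}"

definition tensor_cls :: "cell cset \<Rightarrow> cell cset \<Rightarrow> nat \<Rightarrow> cell \<Rightarrow> cell" where
  "tensor_cls X Y k = class_rep (tensor_rel X Y k)"

definition tensor_op :: "nat \<Rightarrow> oper \<Rightarrow> cell \<Rightarrow> cell" where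
  "tensor_op k g s = (case s of Tens m n x y f \<Rightarrow> Tens m n x y (compose (pts k) f g) | _ \<Rightarrow> s)"

definition tensor :: "cell cset \<Rightarrow> cell cset \<Rightarrow> cell cset" where
  "tensor X Y =
     \<lparr>cells = (\<lambda>k. tensor_cls X Y k ` tensor_gen X Y k),
      act = (\<lambda>k l g s. tensor_cls X Y k (tensor_op k g s))\<rparr>"

text \<open>The pushout of \<open>A \<leftarrow> S \<rightarrow> B\<close> along \<open>\<alpha>\<close> and \<open>\<beta>\<close>.\<close>

definition pushout_rel ::
    "cell cset \<Rightarrow> (nat \<Rightarrow> cell \<Rightarrow> cell) \<Rightarrow> (nat \<Rightarrow> cell \<Rightarrow> cell) \<Rightarrow> nat \<Rightarrow> (cell \<times> cell) set" where
  "pushout_rel S \<alpha> \<beta> k = {(PInl (\<alpha> k s), PInr (\<beta> k s)) |s. s \<in> cells S k}"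

definition pushout_cls ::
    "cell cset \<Rightarrow> (nat \<Rightarrow> cell \<Rightarrow> cell) \<Rightarrow> (nat \<Rightarrow> cell \<Rightarrow> cell) \<Rightarrow> nat \<Rightarrow> cell \<Rightarrow> cell" where
  "pushout_cls S \<alpha> \<beta> k = class_rep (pushout_rel S \<alpha> \<beta> k)"

definition pushout_op :: "cell cset \<Rightarrow> cell cset \<Rightarrow> nat \<Rightarrow> nat \<Rightarrow> oper \<Rightarrow> cell \<Rightarrow> cell" where
  "pushout_op A B m n f s =
     (case s of PInl a \<Rightarrow> PInl (act A m n f a) | PInr b \<Rightarrow> PInr (act B m n f b) | _ \<Rightarrow> s)"

definition pushout ::
    "cell cset \<Rightarrow> cell cset \<Rightarrow> cell cset \<Rightarrow> (nat \<Rightarrow> cell \<Rightarrow> cell) \<Rightarrow> (nat \<Rightarrow> cell \<Rightarrow> cell) \<Rightarrow> cell cset"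
  where
  "pushout A S B \<alpha> \<beta> =
     \<lparr>cells = (\<lambda>k. pushout_cls S \<alpha> \<beta> k ` (PInl ` cells A k \<union> PInr ` cells B k)),
      act = (\<lambda>m n f s. pushout_cls S \<alpha> \<beta> m (pushout_op A B m n f s))\<rparr>"

datatype side = SideL | SideR

fun cylinder :: "side \<Rightarrow> cell cset \<Rightarrow> cell cset" where
  "cylinder SideL X = tensor (cube 1) X"
| "cylinder SideR X = tensor X (cube 1)"

text \<open>The maps \<open>\<partial>\<^sub>1\<^sub>,\<^sub>\<epsilon> \<otimes> X\<close> and \<open>X \<otimes> \<partial>\<^sub>1\<^sub>,\<^sub>\<epsilon>\<close>, precomposed with the unit isomorphisms
  \<open>X \<cong> \<box>^0 \<otimes> X\<close> and \<open>X \<cong> X \<otimes> \<box>^0\<close>.\<close>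

fun cylinder_end :: "side \<Rightarrow> bool \<Rightarrow> cell cset \<Rightarrow> nat \<Rightarrow> cell \<Rightarrow> cell" where
  "cylinder_end SideL e X k x =
     tensor_cls (cube 1) X k (Tens 0 k (Cube (face 0 1 e)) x (idm k))"
| "cylinder_end SideR e X k x =
     tensor_cls X (cube 1) k (Tens k 0 x (Cube (face 0 1 e)) (idm k))"

definition to_point :: "nat \<Rightarrow> cell \<Rightarrow> cell" where
  "to_point k s = Cube (terminal k)"

definition cone :: "side \<Rightarrow> bool \<Rightarrow> cell cset \<Rightarrow> cell cset" where
  "cone W e X = pushout (cube 0) X (cylinder W X) to_point (cylinder_end W e X)"

text \<open>The two legs \<open>\<box>^0 \<rightarrow> C X\<close> and \<open>\<box>^1 \<otimes> X \<rightarrow> C X\<close> (respectively \<open>X \<otimes> \<box>^1 \<rightarrow> C X\<close>).\<close>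

definition cone_apex :: "side \<Rightarrow> bool \<Rightarrow> cell cset \<Rightarrow> nat \<Rightarrow> cell \<Rightarrow> cell" where
  "cone_apex W e X k s = pushout_cls X to_point (cylinder_end W e X) k (PInl s)"

definition cone_leg :: "side \<Rightarrow> bool \<Rightarrow> cell cset \<Rightarrow> nat \<Rightarrow> cell \<Rightarrow> cell" where
  "cone_leg W e X k s = pushout_cls X to_point (cylinder_end W e X) k (PInr s)"


section \<open>The cosimplicial objects \<open>Q\<close>\<close>

definition Q :: "side \<Rightarrow> bool \<Rightarrow> nat \<Rightarrow> cell cset" where
  "Q W e n = (cone W e ^^ Suc n) empty_cset"

text \<open>
  The quotient maps \<open>\<box>^n \<rightarrow> Q^n\<close>.  For \<open>n = 0\<close> this is the isomorphism from \<open>\<box>^0\<close> onto the cone on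
  the empty cubical set.  On level \<open>n + 1\<close> it is the composite
  \<open>\<box>^(n+1) \<cong> \<box>^1 \<otimes> \<box>^n \<rightarrow> \<box>^1 \<otimes> Q^n \<rightarrow> C Q^n\<close> (for R: \<open>\<box>^(n+1) \<cong> \<box>^n \<otimes> \<box>^1 \<rightarrow> Q^n \<otimes> \<box>^1 \<rightarrow> C Q^n\<close>),
  where the isomorphism sends \<open>f\<close> to \<open>(id \<otimes> id) f\<close>.
\<close>

fun quot_map :: "side \<Rightarrow> bool \<Rightarrow> nat \<Rightarrow> nat \<Rightarrow> oper \<Rightarrow> cell" where
  "quot_map W e 0 k f = cone_apex W e empty_cset k (Cube f)"
| "quot_map SideL e (Suc n) k f =
     cone_leg SideL e (Q SideL e n) k
       (tensor_cls (cube 1) (Q SideL e n) k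
         (Tens 1 n (Cube (idm 1)) (quot_map SideL e n n (idm n)) f))"
| "quot_map SideR e (Suc n) k f =
     cone_leg SideR e (Q SideR e n) k
       (tensor_cls (Q SideR e n) (cube 1) k
         (Tens n 1 (quot_map SideR e n n (idm n)) (Cube (idm 1)) f))"

text \<open>The map \<open>Q^m \<rightarrow> Q^n\<close> induced on quotients by \<open>\<delta> : [1]^m \<rightarrow> [1]^n\<close>.\<close>

definition induced :: "side \<Rightarrow> bool \<Rightarrow> nat \<Rightarrow> nat \<Rightarrow> oper \<Rightarrow> nat \<Rightarrow> cell \<Rightarrow> cell" where
  "induced W e m n \<delta> = (THE \<phi>. \<phi> \<in> cset_hom (Q W e m) (Q W e n) \<and>
     (\<forall>k f. box k m f \<longrightarrow>
        \<phi> k (quot_map W e m k f) = quot_map W e n k (compose (pts k) \<delta> f)))"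

text \<open>The underlying cubical operators of the \<open>j\<close>-th coface map from level \<open>n\<close> to level \<open>n + 1\<close>
  (\<open>j \<le> n + 1\<close>) and of the \<open>j\<close>-th codegeneracy map from level \<open>n + 1\<close> to level \<open>n\<close> (\<open>j \<le> n\<close>).\<close>

fun coface_op :: "side \<Rightarrow> bool \<Rightarrow> nat \<Rightarrow> nat \<Rightarrow> oper" where
  "coface_op SideL e n j = (if j = 0 then face n (n + 1) e else face n (n + 2 - j) (\<not> e))"
| "coface_op SideR e n j = (if j = 0 then face n 1 e else face n j (\<not> e))"

fun codegen_op :: "side \<Rightarrow> bool \<Rightarrow> nat \<Rightarrow> nat \<Rightarrow> oper" where
  "codegen_op SideL e n j = (if j = 0 then degen n (n + 1) else conn n (n + 1 - j) (\<not> e))"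
| "codegen_op SideR e n j = (if j = 0 then degen n 1 else conn n j (\<not> e))"

definition coface :: "side \<Rightarrow> bool \<Rightarrow> nat \<Rightarrow> nat \<Rightarrow> nat \<Rightarrow> cell \<Rightarrow> cell" where
  "coface W e n j = induced W e n (Suc n) (coface_op W e n j)"

definition codegen :: "side \<Rightarrow> bool \<Rightarrow> nat \<Rightarrow> nat \<Rightarrow> nat \<Rightarrow> cell \<Rightarrow> cell" where
  "codegen W e n j = induced W e (Suc n) n (codegen_op W e n j)"


section \<open>Simplicial sets\<close>

text \<open>\<open>fc Y n i : Y_(n+1) \<rightarrow> Y_n\<close> is the \<open>i\<close>-th face map (\<open>i \<le> n + 1\<close>) and
  \<open>dg Y n i : Y_n \<rightarrow> Y_(n+1)\<close> the \<open>i\<close>-th degeneracy map (\<open>i \<le> n\<close>).\<close>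

record 'a sset =
  simplices :: "nat \<Rightarrow> 'a set"
  fc :: "nat \<Rightarrow> nat \<Rightarrow> 'a \<Rightarrow> 'a"
  dg :: "nat \<Rightarrow> nat \<Rightarrow> 'a \<Rightarrow> 'a"

definition simplicial_set :: "'a sset \<Rightarrow> bool" where
  "simplicial_set Y \<longleftrightarrow>
     (\<forall>n i. i \<le> Suc n \<longrightarrow> fc Y n i \<in> simplices Y (Suc n) \<rightarrow> simplices Y n) \<and>
     (\<forall>n i. i \<le> n \<longrightarrow> dg Y n i \<in> simplices Y n \<rightarrow> simplices Y (Suc n)) \<and>
     (\<forall>n i j. i < j \<longrightarrow> j \<le> n + 2 \<longrightarrow> (\<forall>s\<in>simplices Y (n + 2).
        fc Y n i (fc Y (n + 1) j s) = fc Y n (j - 1) (fc Y (n + 1) i s))) \<and>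
     (\<forall>n i j. i \<le> j \<longrightarrow> j \<le> n \<longrightarrow> (\<forall>s\<in>simplices Y n.
        dg Y (n + 1) i (dg Y n j s) = dg Y (n + 1) (j + 1) (dg Y n i s))) \<and>
     (\<forall>n i j. i < j \<longrightarrow> j \<le> n + 1 \<longrightarrow> (\<forall>s\<in>simplices Y (n + 1).
        fc Y (n + 1) i (dg Y (n + 1) j s) = dg Y n (j - 1) (fc Y n i s))) \<and>
     (\<forall>n j. j \<le> n \<longrightarrow> (\<forall>s\<in>simplices Y n.
        fc Y n j (dg Y n j s) = s \<and> fc Y n (j + 1) (dg Y n j s) = s)) \<and>
     (\<forall>n i j. j + 1 < i \<longrightarrow> i \<le> n + 2 \<longrightarrow> (\<forall>s\<in>simplices Y (n + 1).
        fc Y (n + 1) i (dg Y (n + 1) j s) = dg Y n j (fc Y n (i - 1) s)))"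

definition sset_iso :: "'a sset \<Rightarrow> 'b sset \<Rightarrow> (nat \<Rightarrow> 'a \<Rightarrow> 'b) \<Rightarrow> bool" where
  "sset_iso Y Z \<phi> \<longleftrightarrow> simplicial_set Y \<and> simplicial_set Z \<and>
     (\<forall>n. bij_betw (\<phi> n) (simplices Y n) (simplices Z n)) \<and>
     (\<forall>n i. i \<le> Suc n \<longrightarrow> (\<forall>s\<in>simplices Y (Suc n). \<phi> n (fc Y n i s) = fc Z n i (\<phi> (Suc n) s))) \<and>
     (\<forall>n i. i \<le> n \<longrightarrow> (\<forall>s\<in>simplices Y n. \<phi> (Suc n) (dg Y n i s) = dg Z n i (\<phi> n s)))"

text \<open>The constant \<open>n\<close>-simplex on a vertex.\<close>

fun const_simplex :: "'a sset \<Rightarrow> nat \<Rightarrow> 'a \<Rightarrow> 'a" where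
  "const_simplex Y 0 y = y"
| "const_simplex Y (Suc n) y = dg Y n 0 (const_simplex Y n y)"

text \<open>The restriction of an \<open>n\<close>-simplex to the vertex \<open>n\<close>.\<close>

fun last_vertex :: "'a sset \<Rightarrow> nat \<Rightarrow> 'a \<Rightarrow> 'a" where
  "last_vertex Y 0 s = s"
| "last_vertex Y (Suc n) s = last_vertex Y n (fc Y n 0 s)"

definition homR :: "'a sset \<Rightarrow> 'a \<Rightarrow> 'a \<Rightarrow> 'a sset" where
  "homR Y y0 y1 =
     \<lparr>simplices = (\<lambda>n. {s \<in> simplices Y (Suc n).
        fc Y n (Suc n) s = const_simplex Y n y0 \<and> last_vertex Y (Suc n) s = y1}),
      fc = (\<lambda>n i. fc Y (Suc n) i),
      dg = (\<lambda>n i. dg Y (Suc n) i)\<rparr>"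

definition homR_map :: "(nat \<Rightarrow> 'a \<Rightarrow> 'b) \<Rightarrow> nat \<Rightarrow> 'a \<Rightarrow> 'b" where
  "homR_map g = (\<lambda>n. g (Suc n))"


section \<open>The functors \<open>\<integral>\<close>\<close>

definition integral :: "side \<Rightarrow> bool \<Rightarrow> 'a cset \<Rightarrow> (nat \<Rightarrow> cell \<Rightarrow> 'a) sset" where
  "integral W e X =
     \<lparr>simplices = (\<lambda>n. cset_hom (Q W e n) X),
      fc = (\<lambda>n j \<phi>. hom_comp (Q W e n) \<phi> (coface W e n j)),
      dg = (\<lambda>n j \<phi>. hom_comp (Q W e (Suc n)) \<phi> (codegen W e n j))\<rparr>"

definition integral_map ::
    "side \<Rightarrow> bool \<Rightarrow> (nat \<Rightarrow> 'a \<Rightarrow> 'b) \<Rightarrow> nat \<Rightarrow> (nat \<Rightarrow> cell \<Rightarrow> 'a) \<Rightarrow> (nat \<Rightarrow> cell \<Rightarrow> 'b)" where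
  "integral_map W e f = (\<lambda>n \<phi>. hom_comp (Q W e n) f \<phi>)"

text \<open>The vertex of \<open>\<integral> X\<close> corresponding to a vertex \<open>x\<close> of \<open>X\<close> under \<open>\<box>^0 \<cong> Q^0\<close>.\<close>

definition integral_vertex :: "side \<Rightarrow> bool \<Rightarrow> 'a cset \<Rightarrow> 'a \<Rightarrow> (nat \<Rightarrow> cell \<Rightarrow> 'a)" where
  "integral_vertex W e X x =
     (THE \<phi>. \<phi> \<in> cset_hom (Q W e 0) X \<and> \<phi> 0 (quot_map W e 0 0 (idm 0)) = x)"


section \<open>Cubical mapping spaces\<close>

fun map_space :: "side \<Rightarrow> 'a cset \<Rightarrow> 'a \<Rightarrow> 'a \<Rightarrow> 'a cset" where
  "map_space SideL X x0 x1 =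
     \<lparr>cells = (\<lambda>n. {s \<in> cells X (Suc n).
        act X n (Suc n) (face n 1 False) s = const_cube X n x0 \<and>
        act X n (Suc n) (face n 1 True) s = const_cube X n x1}),
      act = (\<lambda>m n f s. act X (Suc m) (Suc n) (prod_op 1 m (idm 1) f) s)\<rparr>"
| "map_space SideR X x0 x1 =
     \<lparr>cells = (\<lambda>n. {s \<in> cells X (Suc n).
        act X n (Suc n) (face n (Suc n) False) s = const_cube X n x0 \<and>
        act X n (Suc n) (face n (Suc n) True) s = const_cube X n x1}),
      act = (\<lambda>m n f s. act X (Suc m) (Suc n) (prod_op m 1 f (idm 1)) s)\<rparr>"

text \<open>The map \<open>Map_X(x0, x1) \<rightarrow> Map_Y(f x0, f x1)\<close> induced by \<open>f : X \<rightarrow> Y\<close>.\<close>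

definition map_space_map ::
    "side \<Rightarrow> 'a cset \<Rightarrow> 'a \<Rightarrow> 'a \<Rightarrow> (nat \<Rightarrow> 'a \<Rightarrow> 'b) \<Rightarrow> nat \<Rightarrow> 'a \<Rightarrow> 'b" where
  "map_space_map W X x0 x1 f = (\<lambda>n. restrict (f (Suc n)) (cells (map_space W X x0 x1) n))"


section \<open>Natural isomorphisms\<close>

text \<open>
  In the following, \<open>F\<close> and \<open>G\<close> are functors to simplicial sets from the category of cubical sets with two
  chosen vertices \<open>(X, x0, x1)\<close>; a morphism \<open>(X, x0, x1) \<rightarrow> (Y, f x0, f x1)\<close> is a cubical map
  \<open>f : X \<rightarrow> Y\<close>, and \<open>F' X x0 x1 f\<close> and \<open>G' X x0 x1 f\<close> are its images.  The cubical sets range over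
  all those whose cells are of type \<open>'a\<close>.
\<close>

definition naturally_isomorphic ::
    "('a cset \<Rightarrow> 'a \<Rightarrow> 'a \<Rightarrow> 'b sset) \<Rightarrow>
     ('a cset \<Rightarrow> 'a \<Rightarrow> 'a \<Rightarrow> (nat \<Rightarrow> 'a \<Rightarrow> 'a) \<Rightarrow> nat \<Rightarrow> 'b \<Rightarrow> 'b) \<Rightarrow>
     ('a cset \<Rightarrow> 'a \<Rightarrow> 'a \<Rightarrow> 'c sset) \<Rightarrow>
     ('a cset \<Rightarrow> 'a \<Rightarrow> 'a \<Rightarrow> (nat \<Rightarrow> 'a \<Rightarrow> 'a) \<Rightarrow> nat \<Rightarrow> 'c \<Rightarrow> 'c) \<Rightarrow> bool" where
  "naturally_isomorphic F F' G G' \<longleftrightarrow>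
     (\<exists>\<Phi> :: 'a cset \<Rightarrow> 'a \<Rightarrow> 'a \<Rightarrow> nat \<Rightarrow> 'b \<Rightarrow> 'c.
        (\<forall>X x0 x1. cubical_set X \<longrightarrow> x0 \<in> cells X 0 \<longrightarrow> x1 \<in> cells X 0 \<longrightarrow>
           sset_iso (F X x0 x1) (G X x0 x1) (\<Phi> X x0 x1)) \<and>
        (\<forall>X Y x0 x1 f. cubical_set X \<longrightarrow> cubical_set Y \<longrightarrow> x0 \<in> cells X 0 \<longrightarrow> x1 \<in> cells X 0 \<longrightarrow>
           f \<in> cset_hom X Y \<longrightarrow>
           (\<forall>n. \<forall>s\<in>simplices (F X x0 x1) n.
              \<Phi> Y (f 0 x0) (f 0 x1) n (F' X x0 x1 f n s) = G' X x0 x1 f n (\<Phi> X x0 x1 n s))))"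

end

theory Submission
  imports Defs
begin

text \<open>
  The coordinates of the cube \<open>[1]^n\<close> covering \<open>Q^n\<close> correspond to the \<open>n\<close> cones that are taken
  one after the other.  List them from the newest to the oldest: this is the given order for \<open>L\<close> and
  the reversed order for \<open>R\<close>, and in these coordinates the four cases of the theorem become one.
  A cone contracts the end \<open>\<epsilon>\<close> of its cylinder, so once a coordinate has the value \<open>\<epsilon>\<close> the older
  coordinates after it are irrelevant.  Accordingly \<open>Q^n\<close> is the quotient of \<open>\<box>^n\<close> that identifies two
  operators \<open>[1]^k \<rightarrow> [1]^n\<close> iff they are equal, or have a common initial segment of coordinates that
  is followed, in both of them, by a coordinate that is constantly \<open>\<epsilon>\<close> (relation \<open>sim\<close>, lemma
  \<open>presents_Q\<close>).  A cubical map \<open>Q^n \<rightarrow> X\<close> is therefore the same as an \<open>n\<close>-cube of \<open>X\<close> on which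
  identified operators act equally, here called compatible.  The faces and degeneracies of \<open>\<integral> X\<close> act
  on such cubes through the operators \<open>coface_op\<close> and \<open>codegen_op\<close>.

  Both simplicial sets of the theorem consist, in degree \<open>n\<close>, of \<open>(n+1)\<close>-cubes of \<open>X\<close>, and they turn out
  to be the same cubes (lemma \<open>compat_map_space\<close>).  The relation \<open>sim\<close> on operators into \<open>[1]^(n+1)\<close> is
  generated by the products of an identity on the newest coordinate with related operators into
  \<open>[1]^n\<close>, and by relating any two operators whose newest coordinate is constantly \<open>\<epsilon>\<close> (lemma
  \<open>sim_Suc_induct\<close>).  For a cube \<open>s\<close> of the mapping space, compatibility there accounts for the first
  kind of generators.  The second kind says that the face of \<open>s\<close> at \<open>\<epsilon>\<close> of the newest coordinate is
  constant, which holds in a mapping space.  So compatible \<open>n\<close>-cubes of the mapping space are compatible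
  \<open>(n+1)\<close>-cubes of \<open>X\<close> whose faces in the newest coordinate are constant at the two given vertices.  On
  the other side, the last simplicial face is the face at \<open>1 - \<epsilon>\<close> of the newest coordinate, and
  the last vertex is the value of \<open>s\<close> at \<open>(\<epsilon>, ..., \<epsilon>)\<close>, which determines the face at \<open>\<epsilon>\<close> because that
  face is constant.  These are the two conditions that define \<open>Hom\<^sup>R\<close>.

  Under the identification, which sends a map \<open>Q^n \<rightarrow> Map\<close> to the map \<open>Q^(n+1) \<rightarrow> X\<close> with the same underlying
  cube, structure maps agree because the product of an identity on the newest coordinate with
  the \<open>j\<close>-th coface or codegeneracy is again the \<open>j\<close>-th one, one level higher.  Naturality is immediate, as
  a cubical map acts on either side by its value on the underlying cube.
\<close>

section \<open>Operators between cubes\<close>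

lemma pts_iff [simp]: "v \<in> pts n \<longleftrightarrow> length v = n"
  by (simp add: pts_def)

lemma box_extfun: "box m n f \<Longrightarrow> f \<in> pts m \<rightarrow>\<^sub>E pts n"
proof (induction rule: box.induct)
  case (comp m n f p g)
  then show ?case by (auto simp: compose_def PiE_iff Pi_iff extensional_def)
qed (auto simp: idm_def face_def degen_def conn_def)

lemma box_length [simp]: "box m n f \<Longrightarrow> length v = m \<Longrightarrow> length (f v) = n"
  using box_extfun[of m n f] by (auto simp: PiE_iff)

lemma box_ext:
  assumes "box m n f" "box m n g" "\<And>v. length v = m \<Longrightarrow> f v = g v"
  shows "f = g"
proof (rule PiE_ext)
  show "f \<in> pts m \<rightarrow>\<^sub>E pts n" "g \<in> pts m \<rightarrow>\<^sub>E pts n" using assms box_extfun by blast+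
qed (use assms(3) in auto)

lemma compose_apply [simp]: "length v = m \<Longrightarrow> compose (pts m) g f v = g (f v)"
  by (simp add: compose_def)

lemma box_assoc:
  assumes "box k l f" "box l m g" "box m n h"
  shows "compose (pts k) h (compose (pts k) g f) = compose (pts k) (compose (pts l) h g) f"
  using assms by (intro box_ext[of k n]) (auto intro: box.comp)

lemma compose_idm_right [simp]: "box m n f \<Longrightarrow> compose (pts m) f (idm m) = f"
  by (rule box_ext[of m n]) (auto intro: box.comp box.idm simp: idm_def[THEN fun_cong])

lemma compose_idm_left [simp]: "box m n f \<Longrightarrow> compose (pts m) (idm n) f = f"
  by (rule box_ext[of m n]) (auto intro: box.comp box.idm simp: idm_def[THEN fun_cong])

lemma idm_apply [simp]: "length v = n \<Longrightarrow> idm n v = v"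
  by (simp add: idm_def)

lemma box_terminal: "box n 0 (terminal n)"
proof (induction n)
  case 0
  have "terminal 0 = idm 0" by (auto simp: terminal_def idm_def restrict_def)
  then show ?case using box.idm by simp
next
  case (Suc n)
  have "compose (pts (Suc n)) (terminal n) (degen n 1) = terminal (Suc n)"
    by (auto simp: terminal_def degen_def compose_def restrict_def)
  then show ?case using box.comp[OF box.degen[of 1 n] Suc] by simp
qed

lemma box_0_eq_terminal: "box n 0 f \<longleftrightarrow> f = terminal n"
proof
  assume f: "box n 0 f"
  show "f = terminal n"
    by (rule box_ext[OF f box_terminal]) (use box_length[OF f] in \<open>simp add: terminal_def\<close>)
qed (simp add: box_terminal)

definition const_op :: "nat \<Rightarrow> nat \<Rightarrow> bool \<Rightarrow> oper" where
  "const_op m n e = (\<lambda>v\<in>pts m. replicate n e)"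

lemma const_op_apply [simp]: "length v = m \<Longrightarrow> const_op m n e v = replicate n e"
  by (simp add: const_op_def)

lemma box_const_op: "box m n (const_op m n e)"
proof (induction n)
  case 0
  have "const_op m 0 e = terminal m" by (auto simp: terminal_def const_op_def)
  then show ?case using box_terminal by simp
next
  case (Suc n)
  have "compose (pts m) (face n 1 e) (const_op m n e) = const_op m (Suc n) e"
    by (auto simp: const_op_def face_def compose_def restrict_def)
  then show ?case using box.comp[OF Suc box.face[of 1 n e]] by simp
qed

lemma prod_op_apply [simp]:
  "length v = m + n \<Longrightarrow> prod_op m n f g v = f (take m v) @ g (drop m v)"
  by (simp add: prod_op_def)

lemma prod_op_compose:
  assumes "box m m' f" "box n n' f'" "box m' m'' g" "box n' n'' g'"
  shows "prod_op m n (compose (pts m) g f) (compose (pts n) g' f') =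
     compose (pts (m + n)) (prod_op m' n' g g') (prod_op m n f f')"
  using assms by (auto simp: compose_def prod_op_def restrict_def fun_eq_iff)

lemma drop_take_append: "j \<le> m \<Longrightarrow> drop j (take m x) @ drop m x = drop j x"
  by (metis append_take_drop_id drop_take drop_drop le_add_diff_inverse2)

text \<open>
  A generator of the cube category remains a generator after taking the product with an
  identity; composites follow by functoriality.
\<close>

lemma box_prod_op_idm: "box m m' f \<Longrightarrow> box (m + n) (m' + n) (prod_op m n f (idm n))"
proof (induction rule: box.induct)
  case (idm m)
  have "prod_op m n (idm m) (idm n) = idm (m + n)"
    by (auto simp: prod_op_def idm_def restrict_def)
  then show ?case using box.idm by simp
next
  case (face i m e)
  then have "prod_op m n (face m i e) (idm n) = face (m + n) i e"
    by (auto simp: prod_op_def idm_def face_def restrict_def fun_eq_iff min_def drop_take_append)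
  then show ?case using box.face[of i "m + n" e] face by simp
next
  case (degen i m)
  then have "prod_op (Suc m) n (degen m i) (idm n) = degen (m + n) i"
    by (auto simp: prod_op_def idm_def degen_def restrict_def fun_eq_iff min_def drop_take_append)
  then show ?case using box.degen[of i "m + n"] degen by simp
next
  case (conn i m e)
  then have "prod_op (Suc m) n (conn m i e) (idm n) = conn (m + n) i e"
    by (auto simp: prod_op_def idm_def conn_def restrict_def fun_eq_iff min_def drop_take_append)
  then show ?case using box.conn[of i "m + n"] conn by simp
next
  case (comp m m' f m'' g)
  have "compose (pts (m + n)) (prod_op m' n g (idm n)) (prod_op m n f (idm n)) =
      prod_op m n (compose (pts m) g f) (idm n)"
    using prod_op_compose[OF comp(1) box.idm[of n] comp(2) box.idm[of n]]
    by (simp add: compose_idm_left[OF box.idm])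
  then show ?case using box.comp[OF comp(3,4)] by simp
qed

lemma box_idm_prod_op: "box m m' f \<Longrightarrow> box (n + m) (n + m') (prod_op n m (idm n) f)"
proof -
  have T: "take n x @ take j (drop n x) = take (j + n) x"
    "take n x @ take j (drop n x) @ w = take (j + n) x @ w" for j w and x :: "bool list"
    by (metis add.commute append_assoc take_add)+
  show "box m m' f \<Longrightarrow> box (n + m) (n + m') (prod_op n m (idm n) f)"
  proof (induction rule: box.induct)
    case (idm m)
    have "prod_op n m (idm n) (idm m) = idm (n + m)"
      by (auto simp: prod_op_def idm_def restrict_def)
    then show ?case using box.idm by simp
  next
    case (face i m e)
    then obtain j where i: "i = Suc j" by (cases i) auto
    have "prod_op n m (idm n) (face m i e) = face (n + m) (n + i) e"
      using face by (auto simp: i prod_op_def idm_def face_def restrict_def fun_eq_iff T ac_simps)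
    then show ?case using box.face[of "n + i" "n + m" e] face by simp
  next
    case (degen i m)
    then obtain j where i: "i = Suc j" by (cases i) auto
    have "prod_op n (Suc m) (idm n) (degen m i) = degen (n + m) (n + i)"
      using degen by (auto simp: i prod_op_def idm_def degen_def restrict_def fun_eq_iff T ac_simps)
    then show ?case using box.degen[of "n + i" "n + m"] degen by simp
  next
    case (conn i m e)
    then obtain j where i: "i = Suc j" by (cases i) auto
    have "prod_op n (Suc m) (idm n) (conn m i e) = conn (n + m) (n + i) e"
      using conn by (auto simp: i prod_op_def idm_def conn_def restrict_def fun_eq_iff T ac_simps)
    then show ?case using box.conn[of "n + i" "n + m"] conn by simp
  next
    case (comp m m' f m'' g)
    have "compose (pts (n + m)) (prod_op n m' (idm n) g) (prod_op n m (idm n) f) =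
        prod_op n m (idm n) (compose (pts m) g f)"
      using prod_op_compose[OF box.idm[of n] comp(1) box.idm[of n] comp(2)]
      by (simp add: compose_idm_left[OF box.idm])
    then show ?case using box.comp[OF comp(3,4)] by simp
  qed
qed

text \<open>Factor \<open>f \<otimes> g\<close> as \<open>(f \<otimes> id) (id \<otimes> g)\<close>.\<close>

lemma box_prod_op:
  assumes "box m m' f" "box n n' g"
  shows "box (m + n) (m' + n') (prod_op m n f g)"
proof -
  have "compose (pts (m + n)) (prod_op m n' f (idm n')) (prod_op m n (idm m) g) = prod_op m n f g"
    using prod_op_compose[OF box.idm assms(2) assms(1) box.idm] assms by simp
  then show ?thesis
    using box.comp[OF box_idm_prod_op[OF assms(2), of m] box_prod_op_idm[OF assms(1), of n']] by simp
qed

section \<open>Coordinates ordered from the newest cone coordinate\<close>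

text \<open>
  The cone \<open>C\<^sub>L\<close> puts its cylinder coordinate first and
  \<open>C\<^sub>R\<close> puts it last, so this lists the coordinates of a point from the
  newest to the oldest.
\<close>

definition ord :: "side \<Rightarrow> bool list \<Rightarrow> bool list" where
  "ord W v = (case W of SideL \<Rightarrow> v | SideR \<Rightarrow> rev v)"

lemma ord_simps [simp]:
  "ord SideL v = v" "ord SideR v = rev v" "ord W (ord W v) = v" "length (ord W v) = length v"
  by (auto simp: ord_def split: side.splits)

text \<open>
  The operator \<open>f\<close> read in the reordered coordinates of source and target. The
  formulas below for composites, faces, degeneracies, connections and products in these
  coordinates do not depend on the side, so that \<open>L\<close> and \<open>R\<close> can be
  treated together from here on.
\<close>

definition co :: "side \<Rightarrow> oper \<Rightarrow> bool list \<Rightarrow> bool list" where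
  "co W f u = ord W (f (ord W u))"

lemma box_ext_co:
  assumes "box m n f" "box m n g" "\<And>u. length u = m \<Longrightarrow> co W f u = co W g u"
  shows "f = g"
proof (rule box_ext[OF assms(1,2)])
  fix v :: "bool list" assume "length v = m"
  then have "co W f (ord W v) = co W g (ord W v)" by (intro assms(3)) simp
  then have "ord W (f v) = ord W (g v)" by (simp add: co_def)
  then show "f v = g v" by (metis ord_simps(3))
qed

lemma length_co [simp]: "box m n f \<Longrightarrow> length u = m \<Longrightarrow> length (co W f u) = n"
  by (simp add: co_def)

lemma co_compose [simp]:
  "length u = m \<Longrightarrow> co W (compose (pts m) g f) u = co W g (co W f u)"
  by (simp add: co_def)

lemma co_idm [simp]: "length u = m \<Longrightarrow> co W (idm m) u = u"
  by (simp add: co_def)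

lemma co_const_op [simp]: "length u = m \<Longrightarrow> co W (const_op m n e) u = replicate n e"
  by (cases W) (auto simp: co_def)

text \<open>
  In the next three definitions \<open>i\<close> counts from 0, starting at the newest
  coordinate.
\<close>

definition cface :: "side \<Rightarrow> nat \<Rightarrow> nat \<Rightarrow> bool \<Rightarrow> oper" where
  "cface W n i b = (case W of SideL \<Rightarrow> face n (Suc i) b | SideR \<Rightarrow> face n (Suc n - i) b)"

definition cdegen :: "side \<Rightarrow> nat \<Rightarrow> nat \<Rightarrow> oper" where
  "cdegen W n i = (case W of SideL \<Rightarrow> degen n (Suc i) | SideR \<Rightarrow> degen n (Suc n - i))"

definition cconn :: "side \<Rightarrow> nat \<Rightarrow> nat \<Rightarrow> bool \<Rightarrow> oper" where
  "cconn W n i b = (case W of SideL \<Rightarrow> conn n (Suc i) b | SideR \<Rightarrow> conn n (n - i) b)"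

lemma box_cface: "i \<le> n \<Longrightarrow> box n (Suc n) (cface W n i b)"
  by (auto simp: cface_def intro!: box.face split: side.splits)

lemma box_cdegen: "i \<le> n \<Longrightarrow> box (Suc n) n (cdegen W n i)"
  by (auto simp: cdegen_def intro!: box.degen split: side.splits)

lemma box_cconn: "i < n \<Longrightarrow> box (Suc n) n (cconn W n i b)"
  by (auto simp: cconn_def intro!: box.conn split: side.splits)

lemma co_cface [simp]:
  assumes "length u = n" "i \<le> n"
  shows "co W (cface W n i b) u = take i u @ b # drop i u"
  using assms by (cases W) (auto simp: co_def cface_def face_def rev_take rev_drop)

lemma co_cdegen [simp]:
  assumes "length u = Suc n" "i \<le> n"
  shows "co W (cdegen W n i) u = take i u @ drop (Suc i) u"
  using assms by (cases W) (auto simp: co_def cdegen_def degen_def rev_take rev_drop Suc_diff_le)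

lemma co_cconn [simp]:
  assumes "length u = Suc n" "i < n"
  shows "co W (cconn W n i b) u =
    take i u @ (if b then min (u ! i) (u ! Suc i) else max (u ! i) (u ! Suc i)) # drop (Suc (Suc i)) u"
proof (cases W)
  case SideR
  have "Suc n - (n - i) = Suc i" "Suc n - Suc (n - i) = i" using assms by auto
  then show ?thesis using assms SideR
    by (auto simp: co_def cconn_def conn_def rev_take rev_drop rev_nth Suc_diff_Suc min.commute max.commute)
qed (use assms in \<open>auto simp: co_def cconn_def conn_def\<close>)

text \<open>The product of operators, with the factor on the newer coordinates as the first argument.\<close>

definition par :: "side \<Rightarrow> nat \<Rightarrow> nat \<Rightarrow> oper \<Rightarrow> oper \<Rightarrow> oper" where
  "par W m n f g = (case W of SideL \<Rightarrow> prod_op m n f g | SideR \<Rightarrow> prod_op n m g f)"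

lemma box_par:
  assumes "box m m' f" "box n n' g"
  shows "box (m + n) (m' + n') (par W m n f g)"
  using assms box_prod_op[of m m' f n n' g] box_prod_op[of n n' g m m' f]
  by (auto simp: par_def add.commute split: side.splits)

lemma co_par [simp]:
  assumes "length u = m + n"
  shows "co W (par W m n f g) u = co W f (take m u) @ co W g (drop m u)"
  using assms by (cases W) (auto simp: co_def par_def rev_take rev_drop)

lemma par_compose:
  assumes "box m m' f" "box n n' f'" "box m' m'' g" "box n' n'' g'"
  shows "par W m n (compose (pts m) g f) (compose (pts n) g' f') =
     compose (pts (m + n)) (par W m' n' g g') (par W m n f f')"
  using prod_op_compose[OF assms] prod_op_compose[OF assms(2,1,4,3)]
  by (auto simp: par_def add.commute split: side.splits)

lemma par_idm: "par W m n (idm m) (idm n) = idm (m + n)"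
  using box_par[OF box.idm box.idm, of m n W]
  by (intro box_ext_co[of _ _ _ _ W]) (auto intro: box.idm)

section \<open>The congruence that defines the quotients\<close>

text \<open>
  The index \<open>i\<close> is the position of the coordinate that is constantly
  \<open>\<epsilon>\<close>. Since the cone on that coordinate contracts the end
  \<open>\<epsilon>\<close>, everything after it is forgotten.
\<close>

definition sim :: "side \<Rightarrow> bool \<Rightarrow> nat \<Rightarrow> nat \<Rightarrow> oper \<Rightarrow> oper \<Rightarrow> bool" where
  "sim W e k n f g \<longleftrightarrow> f = g \<or> (\<exists>i<n. \<forall>u. length u = k \<longrightarrow>
     take i (co W f u) = take i (co W g u) \<and> co W f u ! i = e \<and> co W g u ! i = e)"

lemma sim_refl [simp]: "sim W e k n f f"
  by (simp add: sim_def)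

lemma sim_sym: "sim W e k n f g \<Longrightarrow> sim W e k n g f"
  by (auto simp: sim_def)

text \<open>
  Of the two positions at which the coordinate is constantly \<open>\<epsilon>\<close>, the
  smaller one works.
\<close>

lemma sim_trans:
  assumes "sim W e k n f g" "sim W e k n g h" "box k n f" "box k n g" "box k n h"
  shows "sim W e k n f h"
proof (cases "f = g \<or> g = h")
  case True
  then show ?thesis using assms by auto
next
  case False
  from assms False obtain i where i: "i < n" "\<And>u. length u = k \<Longrightarrow>
      take i (co W f u) = take i (co W g u) \<and> co W f u ! i = e \<and> co W g u ! i = e"
    unfolding sim_def by blast
  from assms False obtain j where j: "j < n" "\<And>u. length u = k \<Longrightarrow>
      take j (co W g u) = take j (co W h u) \<and> co W g u ! j = e \<and> co W h u ! j = e"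
    unfolding sim_def by blast
  show ?thesis
  proof (cases i j rule: linorder_cases)
    case less
    have "take i (co W f u) = take i (co W h u) \<and> co W f u ! i = e \<and> co W h u ! i = e"
      if u: "length u = k" for u
    proof -
      have "take i (take j (co W g u)) = take i (take j (co W h u))"
        "take j (co W g u) ! i = take j (co W h u) ! i"
        using j(2)[OF u] by auto
      then show ?thesis using i(2)[OF u] less by auto
    qed
    then show ?thesis using i(1) unfolding sim_def by blast
  next
    case greater
    have "take j (co W f u) = take j (co W h u) \<and> co W f u ! j = e \<and> co W h u ! j = e"
      if u: "length u = k" for u
    proof -
      have "take j (take i (co W f u)) = take j (take i (co W g u))"
        "take i (co W f u) ! j = take i (co W g u) ! j"
        using i(2)[OF u] by auto
      then show ?thesis using j(2)[OF u] greater by auto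
    qed
    then show ?thesis using j(1) unfolding sim_def by blast
  next
    case equal
    then show ?thesis using i j unfolding sim_def by metis
  qed
qed

lemma sim_precomp:
  assumes "sim W e k n f g" "box m k h"
  shows "sim W e m n (compose (pts m) f h) (compose (pts m) g h)"
proof (cases "f = g")
  case False
  then obtain i where i: "i < n" "\<And>u. length u = k \<Longrightarrow>
      take i (co W f u) = take i (co W g u) \<and> co W f u ! i = e \<and> co W g u ! i = e"
    using assms unfolding sim_def by blast
  then show ?thesis
    unfolding sim_def using assms(2) by (intro disjI2 exI[of _ i]) simp
qed simp

lemma sim_par:
  assumes "sim W e k n f g" "box k n f" "box k n g" "box m m' a"
  shows "sim W e (m + k) (m' + n) (par W m k a f) (par W m k a g)"
proof (cases "f = g")
  case False
  then obtain i where i: "i < n" "\<And>u. length u = k \<Longrightarrow>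
      take i (co W f u) = take i (co W g u) \<and> co W f u ! i = e \<and> co W g u ! i = e"
    using assms unfolding sim_def by blast
  then show ?thesis
    unfolding sim_def using assms(2-)
    by (intro disjI2 exI[of _ "m' + i"]) (auto simp: nth_append)
qed simp

text \<open>
  The relation one level up is generated by two kinds of pairs: products of the identity of the
  newest coordinate with a pair one level down, precomposed with any operator, and pairs whose
  newest coordinate is constantly \<open>\<epsilon>\<close>. If \<open>F\<close> and
  \<open>G\<close> share an initial segment that is followed by \<open>\<epsilon>\<close> at a
  position \<open>i > 0\<close>, then both factor through the face that sets coordinate
  \<open>i\<close> to \<open>\<epsilon>\<close>, and this face is related to the operator that
  moreover sets all later coordinates to \<open>\<epsilon>\<close>, after which \<open>F\<close>
  and \<open>G\<close> coincide. The conclusion is stated for an arbitrary function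
  \<open>\<Theta>\<close>; it is applied to the quotient map onto \<open>Q\<close> and to the
  action on a cube.
\<close>

lemma sim_Suc_induct:
  assumes sim: "sim W e k (Suc n) F G" and box: "box k (Suc n) F" "box k (Suc n) G"
    and step: "\<And>k' f g H. box k' n f \<Longrightarrow> box k' n g \<Longrightarrow> sim W e k' n f g \<Longrightarrow> box k (Suc k') H \<Longrightarrow>
        \<Theta> (compose (pts k) (par W 1 k' (idm 1) f) H) = \<Theta> (compose (pts k) (par W 1 k' (idm 1) g) H)"
    and base: "\<And>F G. box k (Suc n) F \<Longrightarrow> box k (Suc n) G \<Longrightarrow>
        (\<And>u. length u = k \<Longrightarrow> co W F u ! 0 = e) \<Longrightarrow> (\<And>u. length u = k \<Longrightarrow> co W G u ! 0 = e) \<Longrightarrow> \<Theta> F = \<Theta> G"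
  shows "\<Theta> F = \<Theta> G"
proof (cases "F = G")
  case False
  then obtain i where i: "i < Suc n" and iu: "\<And>u. length u = k \<Longrightarrow>
      take i (co W F u) = take i (co W G u) \<and> co W F u ! i = e \<and> co W G u ! i = e"
    using sim unfolding sim_def by blast
  show ?thesis
  proof (cases i)
    case 0
    show ?thesis by (rule base[OF box]) (use iu 0 in auto)
  next
    case (Suc j)
    then obtain p where n: "n = Suc p" and j: "j \<le> p" using i by (cases n) auto
    (* f inserts e as coordinate j of the n older ones, which is coordinate i of F and G.  The operator
       t overwrites the coordinates from j on with e, so that g keeps only the part common to F and G. *)
    define f where "f = cface W p j e"
    define t where "t = par W j (p - j) (idm j) (const_op (p - j) (p - j) e)"
    define g where "g = compose (pts p) f t"
    have bf: "box p n f" by (simp add: f_def n box_cface j)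
    have bt: "box p p t"
      using box_par[OF box.idm box_const_op, of j "p - j" "p - j" W e] j by (simp add: t_def)
    have bg: "box p n g" unfolding g_def by (rule box.comp[OF bt bf])
    have sfg: "sim W e p n f g"
      unfolding sim_def using j bt
      by (intro disjI2 exI[of _ j]) (auto simp: f_def g_def t_def n nth_append)
    have bH: "box k (Suc p) (compose (pts k) (cdegen W n i) H)" if "box k (Suc n) H" for H
      using box.comp[OF that box_cdegen[of i n W]] i n by simp
    have b1: "box (Suc p) (Suc n) (par W 1 p (idm 1) h)" if "box p n h" for h
      using box_par[OF box.idm that, of 1 W] by simp
    have bc: "box k (Suc n) (compose (pts k) (par W 1 p (idm 1) h) (compose (pts k) (cdegen W n i) H))"
      if "box p n h" "box k (Suc n) H" for h H
      using box.comp[OF bH[OF that(2)] b1[OF that(1)]] n by simp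
    have eqf: "compose (pts k) (par W 1 p (idm 1) f) (compose (pts k) (cdegen W n i) H) = H"
      if H: "box k (Suc n) H" and e: "\<And>u. length u = k \<Longrightarrow> co W H u ! i = e" for H
    proof (rule box_ext_co[of k "Suc n" _ _ W])
      fix u :: "bool list" assume u: "length u = k"
      obtain b w where bw: "co W H u = b # w" "length w = Suc p"
        using length_co[OF H u, of W] n by (cases "co W H u") auto
      have "w ! j = e" using e[OF u] bw Suc by simp
      then have "take j w @ e # drop (Suc j) w = w"
        using bw j id_take_nth_drop[of j w] by simp
      then show "co W (compose (pts k) (par W 1 p (idm 1) f) (compose (pts k) (cdegen W n i) H)) u
          = co W H u"
        using u bw(2) j by (simp add: f_def Suc n bw(1))
    qed (use bc[OF bf] H in blast)+
    have co_g: "co W (compose (pts k) (par W 1 p (idm 1) g) (compose (pts k) (cdegen W n i) H)) u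
          = take i (co W H u) @ replicate (n - j) e"
      if H: "box k (Suc n) H" and u: "length u = k" for H u
    proof -
      obtain b w where bw: "co W H u = b # w" "length w = Suc p"
        using length_co[OF H u, of W] n by (cases "co W H u") auto
      then show ?thesis
        using u bw(2) j by (simp add: f_def g_def t_def Suc n bw(1) Suc_diff_le)
    qed
    have "\<Theta> F = \<Theta> (compose (pts k) (par W 1 p (idm 1) f) (compose (pts k) (cdegen W n i) F))"
      by (rule arg_cong[OF eqf[OF box(1), symmetric]]) (use iu in blast)
    also have "\<dots> = \<Theta> (compose (pts k) (par W 1 p (idm 1) g) (compose (pts k) (cdegen W n i) F))"
      by (rule step[OF bf bg sfg bH[OF box(1)]])
    also have "compose (pts k) (par W 1 p (idm 1) g) (compose (pts k) (cdegen W n i) F) =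
        compose (pts k) (par W 1 p (idm 1) g) (compose (pts k) (cdegen W n i) G)"
    proof (rule box_ext_co[of k "Suc n" _ _ W])
      show "co W (compose (pts k) (par W 1 p (idm 1) g) (compose (pts k) (cdegen W n i) F)) u =
          co W (compose (pts k) (par W 1 p (idm 1) g) (compose (pts k) (cdegen W n i) G)) u"
        if "length u = k" for u
        unfolding co_g[OF box(1) that] co_g[OF box(2) that] using iu[OF that] by simp
    qed (use bc[OF bg] box in blast)+
    also have "\<Theta> \<dots> = \<Theta> (compose (pts k) (par W 1 p (idm 1) f) (compose (pts k) (cdegen W n i) G))"
      by (rule step[OF bf bg sfg bH[OF box(2)], symmetric])
    also have "\<dots> = \<Theta> G"
      by (rule arg_cong[OF eqf[OF box(2)]]) (use iu in blast)
    finally show ?thesis .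
  qed
qed simp

section \<open>Geometric products and cones\<close>

text \<open>
  Quotients are formed by choosing representatives, so this is the way to show that an operation
  is well defined on classes and to separate classes by an invariant.
\<close>

lemma class_rep_invariant:
  assumes "\<And>x y. (x, y) \<in> r \<Longrightarrow> F x = F y"
  shows "F (class_rep r x) = F x"
proof -
  have "(x, class_rep r x) \<in> (r \<union> r\<inverse>)\<^sup>*"
    unfolding class_rep_def by (rule someI[of _ x]) simp
  then show ?thesis
    by induction (use assms in fastforce)+
qed

lemma class_rep_eq:
  assumes "(x, y) \<in> r"
  shows "class_rep r x = class_rep r y"
proof -
  have "(x, y) \<in> (r \<union> r\<inverse>)\<^sup>*" "(y, x) \<in> (r \<union> r\<inverse>)\<^sup>*" using assms by auto
  then have "(x, z) \<in> (r \<union> r\<inverse>)\<^sup>* \<longleftrightarrow> (y, z) \<in> (r \<union> r\<inverse>)\<^sup>*" for z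
    by (meson rtrancl_trans)
  then show ?thesis by (simp add: class_rep_def)
qed

lemma tensor_cls_eq:
  assumes "box m m' a" "box n n' b" "x \<in> cells X m'" "y \<in> cells Y n'" "box k (m + n) f"
  shows "tensor_cls X Y k (Tens m n (act X m m' a x) (act Y n n' b y) f) =
    tensor_cls X Y k (Tens m' n' x y (compose (pts k) (prod_op m n a b) f))"
  unfolding tensor_cls_def using assms by (intro class_rep_eq) (auto simp: tensor_rel_def)

lemma tensor_cls_invariant:
  assumes "\<And>m n m' n' a b x y f. box m m' a \<Longrightarrow> box n n' b \<Longrightarrow> x \<in> cells X m' \<Longrightarrow> y \<in> cells Y n' \<Longrightarrow>
      box k (m + n) f \<Longrightarrow> F (Tens m n (act X m m' a x) (act Y n n' b y) f) =
        F (Tens m' n' x y (compose (pts k) (prod_op m n a b) f))"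
  shows "F (tensor_cls X Y k t) = F t"
  unfolding tensor_cls_def
  by (rule class_rep_invariant) (auto simp: tensor_rel_def intro: assms)

lemma tensor_act:
  assumes "box k l g"
  shows "act (tensor X Y) k l g (tensor_cls X Y l (Tens m n x y f)) =
    tensor_cls X Y k (Tens m n x y (compose (pts k) f g))"
proof -
  let ?F = "\<lambda>s. tensor_cls X Y k (tensor_op k g s)"
  have "?F (tensor_cls X Y l (Tens m n x y f)) = ?F (Tens m n x y f)"
  proof (rule tensor_cls_invariant)
    fix m n m' n' a b x y f
    assume *: "box m m' a" "box n n' b" "x \<in> cells X m'" "y \<in> cells Y n'" "box l (m + n) f"
    show "?F (Tens m n (act X m m' a x) (act Y n n' b y) f) =
        ?F (Tens m' n' x y (compose (pts l) (prod_op m n a b) f))"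
      using tensor_cls_eq[OF *(1-4) box.comp[OF assms *(5)]]
        box_assoc[OF assms *(5) box_prod_op[OF *(1,2)]]
      by (simp add: tensor_op_def)
  qed
  then show ?thesis by (simp add: tensor_def tensor_op_def)
qed

text \<open>
  The cylinder coordinate is the first argument; on the right-hand side it becomes the second
  factor.
\<close>

definition tens :: "side \<Rightarrow> nat \<Rightarrow> nat \<Rightarrow> cell \<Rightarrow> cell \<Rightarrow> oper \<Rightarrow> cell" where
  "tens W m n a y f = (case W of SideL \<Rightarrow> Tens m n a y f | SideR \<Rightarrow> Tens n m y a f)"

definition cyl_cls :: "side \<Rightarrow> cell cset \<Rightarrow> nat \<Rightarrow> cell \<Rightarrow> cell" where
  "cyl_cls W X = (case W of SideL \<Rightarrow> tensor_cls (cube 1) X | SideR \<Rightarrow> tensor_cls X (cube 1))"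

lemma tens_inject [simp]:
  "tens W m n a y f = tens W m' n' a' y' f' \<longleftrightarrow> m = m' \<and> n = n' \<and> a = a' \<and> y = y' \<and> f = f'"
  by (cases W) (auto simp: tens_def)

lemma cylinder_end_eq:
  "cylinder_end W e X k x = cyl_cls W X k (tens W 0 k (Cube (face 0 1 e)) x (idm k))"
  by (cases W) (auto simp: cyl_cls_def tens_def)

lemma cells_cube: "cells (cube N) n = Cube ` {f. box n N f}"
  by (auto simp: cube_def)

lemma act_cube [simp]: "act (cube N) m n f (Cube g) = Cube (compose (pts m) g f)"
  by (simp add: cube_def cube_op_def)

lemma cells_cylinder:
  "cells (cylinder W X) k = cyl_cls W X k `
     {tens W m n (Cube a) y f |m n a y f. box m 1 a \<and> y \<in> cells X n \<and> box k (m + n) f}"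
proof (cases W)
  case SideL
  have "tensor_gen (cube 1) X k =
     {Tens m n (Cube a) y f |m n a y f. box m 1 a \<and> y \<in> cells X n \<and> box k (m + n) f}"
    unfolding tensor_gen_def cells_cube by blast
  with SideL show ?thesis by (simp add: tensor_def cyl_cls_def tens_def)
next
  case SideR
  have "tensor_gen X (cube 1) k =
     {Tens n m y (Cube a) f |m n a y f. box m 1 a \<and> y \<in> cells X n \<and> box k (m + n) f}"
    unfolding tensor_gen_def cells_cube by (subst add.commute) blast
  with SideR show ?thesis by (simp add: tensor_def cyl_cls_def tens_def)
qed

lemma cyl_cls_eq:
  assumes "box m m' a" "box m' 1 c" "box n n' b" "y \<in> cells X n'" "box k (m + n) f"
  shows "cyl_cls W X k (tens W m n (Cube (compose (pts m) c a)) (act X n n' b y) f) =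
    cyl_cls W X k (tens W m' n' (Cube c) y (compose (pts k) (par W m n a b) f))"
proof (cases W)
  case SideL
  with tensor_cls_eq[OF assms(1,3) _ assms(4,5), of "Cube c" "cube 1"] assms(2) show ?thesis
    by (simp add: cyl_cls_def tens_def par_def cells_cube)
next
  case SideR
  from assms(5) have "box k (n + m) f" by (simp add: add.commute)
  from SideR tensor_cls_eq[OF assms(3,1,4) _ this, of "Cube c" "cube 1"] assms(2) show ?thesis
    by (simp add: cyl_cls_def tens_def par_def cells_cube)
qed

lemma cyl_cls_invariant:
  assumes "\<And>m n m' n' a b c y f. box m m' a \<Longrightarrow> box m' 1 c \<Longrightarrow> box n n' b \<Longrightarrow> y \<in> cells X n' \<Longrightarrow>
      box k (m + n) f \<Longrightarrow> F (tens W m n (Cube (compose (pts m) c a)) (act X n n' b y) f) =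
        F (tens W m' n' (Cube c) y (compose (pts k) (par W m n a b) f))"
  shows "F (cyl_cls W X k t) = F t"
proof (cases W)
  case SideL
  have "F (tensor_cls (cube 1) X k t) = F t"
    by (rule tensor_cls_invariant)
      (use assms SideL in \<open>auto simp: cells_cube tens_def par_def\<close>)
  with SideL show ?thesis by (simp add: cyl_cls_def)
next
  case SideR
  have "F (tensor_cls X (cube 1) k t) = F t"
    by (rule tensor_cls_invariant)
      (use assms SideR in \<open>auto simp: cells_cube tens_def par_def add.commute\<close>)
  with SideR show ?thesis by (simp add: cyl_cls_def)
qed

text \<open>
  The action only touches the last component of a generator, on which the relation acts by
  postcomposition.
\<close>

lemma cylinder_act:
  assumes "box k l g"
  shows "act (cylinder W X) k l g (cyl_cls W X l (tens W m n a y f)) =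
    cyl_cls W X k (tens W m n a y (compose (pts k) f g))"
  using tensor_act[OF assms] by (cases W) (auto simp: cyl_cls_def tens_def)

lemma cylinder_end_act:
  assumes "box m k h" "x \<in> cells X k"
  shows "act (cylinder W X) m k h (cylinder_end W e X k x) = cylinder_end W e X m (act X m k h x)"
proof -
  have par: "par W 0 m (idm 0) h = h"
    using box_par[OF box.idm[of 0] assms(1), of W] assms
    by (intro box_ext_co[of m k _ _ W]) simp_all
  have "cyl_cls W X m (tens W 0 m (Cube (compose (pts 0) (face 0 1 e) (idm 0))) (act X m k h x) (idm m))
     = cyl_cls W X m (tens W 0 k (Cube (face 0 1 e)) x (compose (pts m) (par W 0 m (idm 0) h) (idm m)))"
    using box.face[of 1 0 e] assms by (intro cyl_cls_eq) (auto intro: box.idm)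
  then show ?thesis
    using assms box.face[of 1 0 e] by (simp add: cylinder_end_eq cylinder_act par)
qed

lemma cells_cone:
  "cells (cone W e X) k = cone_apex W e X k ` cells (cube 0) k \<union> cone_leg W e X k ` cells (cylinder W X) k"
  by (auto simp: cone_def pushout_def cone_apex_def cone_leg_def)

lemma cone_glue:
  "x \<in> cells X k \<Longrightarrow>
    cone_apex W e X k (Cube (terminal k)) = cone_leg W e X k (cylinder_end W e X k x)"
  unfolding cone_apex_def cone_leg_def pushout_cls_def
  by (rule class_rep_eq) (auto simp: pushout_rel_def to_point_def)

lemma pushout_cls_invariant:
  assumes "\<And>s. s \<in> cells S k \<Longrightarrow> F (PInl (\<alpha> k s)) = F (PInr (\<beta> k s))"
  shows "F (pushout_cls S \<alpha> \<beta> k t) = F t"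
  unfolding pushout_cls_def
  by (rule class_rep_invariant) (auto simp: pushout_rel_def assms)

lemma cone_act:
  assumes h: "box m k h" and closed: "\<And>x. x \<in> cells X k \<Longrightarrow> act X m k h x \<in> cells X m"
  shows "act (cone W e X) m k h (cone_apex W e X k a) = cone_apex W e X m (act (cube 0) m k h a)"
    and "act (cone W e X) m k h (cone_leg W e X k c) = cone_leg W e X m (act (cylinder W X) m k h c)"
proof -
  let ?cls = "pushout_cls X to_point (cylinder_end W e X)"
  let ?F = "\<lambda>s. ?cls m (pushout_op (cube 0) (cylinder W X) m k h s)"
  have F: "?F (?cls k t) = ?F t" for t
  proof (rule pushout_cls_invariant)
    fix s assume s: "s \<in> cells X k"
    have "compose (pts m) (terminal k) h = terminal m"
      using box_0_eq_terminal box.comp[OF h box_terminal] by blast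
    with cone_glue[OF closed[OF s], of W e] cylinder_end_act[OF h s, of W e]
    show "?F (PInl (to_point k s)) = ?F (PInr (cylinder_end W e X k s))"
      by (simp add: pushout_op_def to_point_def cone_apex_def cone_leg_def)
  qed
  then show "act (cone W e X) m k h (cone_apex W e X k a) = cone_apex W e X m (act (cube 0) m k h a)"
    "act (cone W e X) m k h (cone_leg W e X k c) = cone_leg W e X m (act (cylinder W X) m k h c)"
    by (simp_all add: cone_def cone_apex_def cone_leg_def pushout_def pushout_op_def)
qed

section \<open>The quotient presentation of \<open>Q\<close>\<close>

text \<open>
  The map \<open>q\<close> exhibits \<open>X\<close> as the quotient of \<open>\<box>^n\<close>
  by \<open>sim\<close>.
\<close>

definition presents :: "side \<Rightarrow> bool \<Rightarrow> nat \<Rightarrow> cell cset \<Rightarrow> (nat \<Rightarrow> oper \<Rightarrow> cell) \<Rightarrow> bool" where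
  "presents W e n X q \<longleftrightarrow>
     (\<forall>k. cells X k = q k ` {f. box k n f}) \<and>
     (\<forall>m k f h. box k n f \<longrightarrow> box m k h \<longrightarrow> act X m k h (q k f) = q m (compose (pts m) f h)) \<and>
     (\<forall>k f g. box k n f \<longrightarrow> box k n g \<longrightarrow> (q k f = q k g \<longleftrightarrow> sim W e k n f g))"

text \<open>
  Forming a cone adds a newest coordinate. By \<open>sim_Suc_induct\<close>, operators related
  by \<open>sim\<close> have equal images: the first kind of generators is absorbed by the
  relations of the geometric product and the second one by the pushout. Conversely, an invariant
  separates the classes. To the generator \<open>(a \<otimes> q b) f\<close> of the cylinder it
  assigns the \<open>sim\<close>-class of \<open>(a \<otimes> b) f\<close>, and to the apex the
  class of all operators whose newest coordinate is constantly \<open>\<epsilon>\<close>.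
\<close>

lemma presents_cone:
  fixes q W e n X
  defines "q' \<equiv> \<lambda>k f. cone_leg W e X k
      (cyl_cls W X k (tens W 1 n (Cube (idm 1)) (q n (idm n)) f))"
  assumes X: "presents W e n X q"
  shows "presents W e (Suc n) (cone W e X) q'"
proof -
  have cells: "cells X k = q k ` {f. box k n f}" for k
    using X by (auto simp: presents_def)
  have act: "act X m k h (q k f) = q m (compose (pts m) f h)" if "box k n f" "box m k h" for m k h f
    using X that by (auto simp: presents_def)
  have ker: "q k f = q k g \<longleftrightarrow> sim W e k n f g" if "box k n f" "box k n g" for k f g
    using X that by (auto simp: presents_def)
  have q_in: "q k f \<in> cells X k" if "box k n f" for k f
    using that cells by auto
  have closed: "act X m k h x \<in> cells X m" if "box m k h" "x \<in> cells X k" for m k h x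
    using that cells act by (auto intro: box.comp)
  have leg: "cone_leg W e X k (cyl_cls W X k (tens W m n' (Cube a) (q n' b) f)) =
      q' k (compose (pts k) (par W m n' a b) f)"
    if "box m 1 a" "box n' n b" "box k (m + n') f" for k m n' a b f
    using cyl_cls_eq[OF that(1) box.idm that(2) q_in[OF box.idm] that(3), of W] act[OF box.idm that(2)] that
    by (simp add: q'_def)
  have bpar: "box (m + n') (Suc n) (par W m n' a b)" if "box m 1 a" "box n' n b" for m n' a b
    using box_par[OF that, of W] by simp
  (* The apex is the class of every operator with newest coordinate constantly e. *)
  have apex: "cone_apex W e X k (Cube (terminal k)) = q' k (par W 0 k (face 0 1 e) b)"
    if "box k n b" for k b
    using cone_glue[OF q_in[OF that], of W e] leg[of 0 "face 0 1 e" k b k "idm k"]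
      bpar[of 0 "face 0 1 e" k b] box.face[of 1 0 e] that box.idm[of k]
    by (simp add: cylinder_end_eq)
  have ex_box: "\<exists>b. box k n b" for k
    using box_const_op by blast

  have cells_cone_eq: "cells (cone W e X) k = q' k ` {f. box k (Suc n) f}" for k
  proof (intro equalityI subsetI)
    fix c assume "c \<in> cells (cone W e X) k"
    then consider t where "box k 0 t" "c = cone_apex W e X k (Cube t)"
      | m n' a b f where "box m 1 a" "box n' n b" "box k (m + n') f"
        "c = cone_leg W e X k (cyl_cls W X k (tens W m n' (Cube a) (q n' b) f))"
      unfolding cells_cone cells_cube cells_cylinder cells by blast
    then show "c \<in> q' k ` {f. box k (Suc n) f}"
    proof cases
      case 1
      obtain b where b: "box k n b" using ex_box by blast
      show ?thesis using 1 apex[OF b] bpar[of 0 "face 0 1 e" k b] box.face[of 1 0 e] b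
        by (auto simp: box_0_eq_terminal)
    next
      case 2
      then show ?thesis using leg box.comp[OF 2(3) bpar[OF 2(1,2)]] by auto
    qed
  next
    fix c assume "c \<in> q' k ` {f. box k (Suc n) f}"
    then obtain f where f: "box k (1 + n) f" "c = q' k f" by auto
    show "c \<in> cells (cone W e X) k"
      unfolding cells_cone cells_cylinder f(2) q'_def
      using f(1) box.idm[of 1] q_in[OF box.idm] by blast
  qed
  have act_cone_eq: "act (cone W e X) m k h (q' k f) = q' m (compose (pts m) f h)"
    if "box k (Suc n) f" "box m k h" for m k h f
    unfolding q'_def by (simp add: cone_act(2)[OF that(2) closed[OF that(2)]] cylinder_act[OF that(2)])
  have eq_if_sim: "q' k F = q' k G" if FG: "box k (Suc n) F" "box k (Suc n) G" "sim W e k (Suc n) F G" for k F G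
  proof (rule sim_Suc_induct[OF FG(3,1,2)])
    fix k' f g H
    assume *: "box k' n f" "box k' n g" "sim W e k' n f g" "box k (Suc k') H"
    show "q' k (compose (pts k) (par W 1 k' (idm 1) f) H) = q' k (compose (pts k) (par W 1 k' (idm 1) g) H)"
      using leg[OF box.idm *(1), of k H] leg[OF box.idm *(2), of k H] ker[OF *(1,2)] * by simp
  next
    have *: "q' k F = cone_apex W e X k (Cube (terminal k))"
      if F: "box k (Suc n) F" and 0: "\<And>u. length u = k \<Longrightarrow> co W F u ! 0 = e" for F
    proof -
      have b: "box k n (compose (pts k) (cdegen W n 0) F)"
        using box.comp[OF F box_cdegen[of 0 n W]] by simp
      have "par W 0 k (face 0 1 e) (compose (pts k) (cdegen W n 0) F) = F"
      proof (rule box_ext_co[of k "Suc n" _ _ W])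
        fix u :: "bool list" assume u: "length u = k"
        have "co W (face 0 1 e) [] = [e]" by (cases W) (auto simp: co_def face_def)
        moreover obtain w where "co W F u = e # w"
          using 0[OF u] length_co[OF F u, of W] by (cases "co W F u") auto
        ultimately show "co W (par W 0 k (face 0 1 e) (compose (pts k) (cdegen W n 0) F)) u = co W F u"
          using u length_co[OF F u, of W] by simp
      qed (use F bpar[of 0 "face 0 1 e" k, OF _ b] box.face[of 1 0 e] in auto)
      with apex[OF b] show ?thesis by simp
    qed
    fix F G
    assume "box k (Suc n) F" "box k (Suc n) G" "\<And>u. length u = k \<Longrightarrow> co W F u ! 0 = e"
      "\<And>u. length u = k \<Longrightarrow> co W G u ! 0 = e"
    then show "q' k F = q' k G" by (simp add: *)
  qed
  have sim_if_eq: "sim W e k (Suc n) F G"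
    if F: "box k (Suc n) F" and G: "box k (Suc n) G" and eq: "q' k F = q' k G" for k F G
  proof -
    (* The invariant, first on generators of the cylinder and then on the summands of the pushout. *)
    define T where "T c = {g. box k (Suc n) g \<and> (\<exists>m n' a b f. c = tens W m n' (Cube a) (q n' b) f \<and>
        box m 1 a \<and> box n' n b \<and> box k (m + n') f \<and>
        sim W e k (Suc n) g (compose (pts k) (par W m n' a b) f))}" for c
    define P where "P t = (case t of PInr c \<Rightarrow> T c
        | _ \<Rightarrow> {g. box k (Suc n) g \<and> (\<forall>u. length u = k \<longrightarrow> co W g u ! 0 = e)})" for t
    have T_tens: "T (tens W m n' (Cube a) (q n' b) f) =
        {g. box k (Suc n) g \<and> sim W e k (Suc n) g (compose (pts k) (par W m n' a b) f)}"
      if a: "box m 1 a" and b: "box n' n b" and f: "box k (m + n') f" for m n' a b f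
    proof -
      have "sim W e k (Suc n) g (compose (pts k) (par W m n' a b) f)"
        if g: "box k (Suc n) g" and b': "box n' n b'" and q: "q n' b = q n' b'"
          and s: "sim W e k (Suc n) g (compose (pts k) (par W m n' a b') f)" for g b'
      proof -
        have "sim W e n' n b' b" using ker[OF b b'] q sim_sym by blast
        from sim_precomp[OF sim_par[OF this b' b a] f]
        have "sim W e k (Suc n) (compose (pts k) (par W m n' a b') f) (compose (pts k) (par W m n' a b) f)"
          by simp
        with s show ?thesis
          by (rule sim_trans[OF _ _ g])
            (use box.comp[OF f bpar[OF a b]] box.comp[OF f bpar[OF a b']] in auto)
      qed
      then show ?thesis unfolding T_def using a b f by auto
    qed
    have T_cls: "T (cyl_cls W X k t) = T t" for t
    proof (rule cyl_cls_invariant)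
      fix m n1 m' n' a b c y f
      assume *: "box m m' a" "box m' 1 c" "box n1 n' b" "y \<in> cells X n'" "box k (m + n1) f"
      then obtain b0 where b0: "box n' n b0" "y = q n' b0" using cells by auto
      have "compose (pts k) (par W m n1 (compose (pts m) c a) (compose (pts n1) b0 b)) f =
          compose (pts k) (par W m' n' c b0) (compose (pts k) (par W m n1 a b) f)"
        using par_compose[OF *(1,3,2) b0(1), of W]
          box_assoc[OF *(5) box_par[OF *(1,3), of W] bpar[OF *(2) b0(1)]] by simp
      then show "T (tens W m n1 (Cube (compose (pts m) c a)) (act X n1 n' b y) f) =
          T (tens W m' n' (Cube c) y (compose (pts k) (par W m n1 a b) f))"
        using T_tens[OF box.comp[OF *(1,2)] box.comp[OF *(3) b0(1)] *(5)]
          T_tens[OF *(2) b0(1) box.comp[OF *(5) box_par[OF *(1,3), of W]]] act[OF b0(1) *(3)]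
        by (simp add: b0(2))
    qed
    have P_cls: "P (pushout_cls X to_point (cylinder_end W e X) k t) = P t" for t
    proof (rule pushout_cls_invariant)
      fix s assume "s \<in> cells X k"
      then obtain b where b: "box k n b" "s = q k b" using cells by auto
      have fe: "box 0 1 (face 0 1 e)" using box.face[of 1 0 e] by simp
      have bp: "box k (Suc n) (par W 0 k (face 0 1 e) b)" using bpar[OF fe b(1)] by simp
      have hd: "co W (par W 0 k (face 0 1 e) b) u ! 0 = e" if "length u = k" for u
        using that by (cases W) (auto simp: co_def face_def par_def)
      have "sim W e k (Suc n) g (par W 0 k (face 0 1 e) b) \<longleftrightarrow> (\<forall>u. length u = k \<longrightarrow> co W g u ! 0 = e)"
        (is "?l \<longleftrightarrow> ?r") for g
      proof
        assume ?l
        then consider "g = par W 0 k (face 0 1 e) b" | i where "\<And>u. length u = k \<Longrightarrow>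
           take i (co W g u) = take i (co W (par W 0 k (face 0 1 e) b) u) \<and> co W g u ! i = e"
          unfolding sim_def by blast
        then show ?r
        proof cases
          case 2
          show ?r
          proof (intro allI impI)
            fix u :: "bool list" assume u: "length u = k"
            show "co W g u ! 0 = e"
              using 2[OF u] hd[OF u] by (cases i) (auto dest: arg_cong[of _ _ "\<lambda>l. l ! 0"])
          qed
        qed (use hd in auto)
      next
        assume ?r
        then show ?l unfolding sim_def using hd by auto
      qed
      then show "P (PInl (to_point k s)) = P (PInr (cylinder_end W e X k s))"
        using T_tens[OF fe b(1), of "idm k"] box.idm[of k] bp b(2)
        by (simp add: P_def cylinder_end_eq T_cls)
    qed
    have P: "P (pushout_cls X to_point (cylinder_end W e X) k
        (PInr (cyl_cls W X k (tens W 1 n (Cube (idm 1)) (q n (idm n)) F)))) =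
        {g. box k (Suc n) g \<and> sim W e k (Suc n) g F}" if "box k (Suc n) F" for F
    proof -
      have "box k (1 + n) F" using that by simp
      then have "T (tens W 1 n (Cube (idm 1)) (q n (idm n)) F) =
          {g. box k (Suc n) g \<and> sim W e k (Suc n) g F}"
        using T_tens[OF box.idm box.idm, of F] that unfolding par_idm by simp
      then show ?thesis unfolding P_cls unfolding P_def by (simp only: cell.case T_cls)
    qed
    have "{g. box k (Suc n) g \<and> sim W e k (Suc n) g F} = {g. box k (Suc n) g \<and> sim W e k (Suc n) g G}"
      unfolding P[OF F, symmetric] P[OF G, symmetric]
      using eq unfolding q'_def cone_leg_def by (rule arg_cong)
    then show ?thesis using F sim_refl by blast
  qed
  show ?thesis
    unfolding presents_def by (intro conjI allI impI iffI) (fact cells_cone_eq, erule (1) act_cone_eq, erule (2) sim_if_eq, erule (2) eq_if_sim)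
qed

lemma quot_map_Suc:
  "quot_map W e (Suc n) k f = cone_leg W e (Q W e n) k
    (cyl_cls W (Q W e n) k (tens W 1 n (Cube (idm 1)) (quot_map W e n n (idm n)) f))"
  by (cases W) (simp_all add: cyl_cls_def tens_def)

lemma presents_Q: "presents W e n (Q W e n) (quot_map W e n)"
proof (induction n)
  case 0
  have rel: "pushout_cls empty_cset to_point (cylinder_end W e empty_cset) k t = t" for k t
    by (auto simp: pushout_cls_def pushout_rel_def empty_cset_def class_rep_def)
  have cyl: "cells (cylinder W empty_cset) k = {}" for k
    by (simp add: cells_cylinder) (simp add: empty_cset_def)
  have Q0: "Q W e 0 = cone W e empty_cset" by (simp add: Q_def)
  have "cells (Q W e 0) k = quot_map W e 0 k ` {f. box k 0 f}" for k
    by (auto simp: Q0 cells_cone cyl cells_cube)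
  moreover have "act (Q W e 0) m k h (quot_map W e 0 k f) = quot_map W e 0 m (compose (pts m) f h)"
    if "box m k h" for m k h f
    by (simp add: Q0) (subst cone_act(1)[OF that], simp_all add: empty_cset_def)
  moreover have "quot_map W e 0 k f = quot_map W e 0 k g \<longleftrightarrow> sim W e k 0 f g" for k f g
    by (simp add: cone_apex_def rel sim_def)
  ultimately show ?case unfolding presents_def by blast
next
  case (Suc n)
  have "quot_map W e (Suc n) = (\<lambda>k f. cone_leg W e (Q W e n) k
    (cyl_cls W (Q W e n) k (tens W 1 n (Cube (idm 1)) (quot_map W e n n (idm n)) f)))"
    by (intro ext) (rule quot_map_Suc)
  moreover have "Q W e (Suc n) = cone W e (Q W e n)" by (simp add: Q_def)
  ultimately show ?case using presents_cone[OF Suc.IH] by simp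
qed

section \<open>Cubical maps out of \<open>Q\<close> as compatible cubes\<close>

lemma act_in: "cubical_set X \<Longrightarrow> box m n f \<Longrightarrow> s \<in> cells X n \<Longrightarrow> act X m n f s \<in> cells X m"
  by (auto simp: cubical_set_def)

lemma act_idm: "cubical_set X \<Longrightarrow> s \<in> cells X n \<Longrightarrow> act X n n (idm n) s = s"
  by (auto simp: cubical_set_def)

lemma act_compose:
  "cubical_set X \<Longrightarrow> box m n f \<Longrightarrow> box n p g \<Longrightarrow> s \<in> cells X p \<Longrightarrow>
    act X m p (compose (pts m) g f) s = act X m n f (act X n p g s)"
  by (auto simp: cubical_set_def)

lemma cells_Q: "cells (Q W e n) k = quot_map W e n k ` {f. box k n f}"
  using presents_Q[of W e n] unfolding presents_def by blast

lemma act_Q: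
  "box k n f \<Longrightarrow> box m k h \<Longrightarrow>
    act (Q W e n) m k h (quot_map W e n k f) = quot_map W e n m (compose (pts m) f h)"
  using presents_Q[of W e n] unfolding presents_def by blast

lemma quot_map_eq_iff:
  "box k n f \<Longrightarrow> box k n g \<Longrightarrow> quot_map W e n k f = quot_map W e n k g \<longleftrightarrow> sim W e k n f g"
  using presents_Q[of W e n] unfolding presents_def by blast

lemma quot_map_in: "box k n f \<Longrightarrow> quot_map W e n k f \<in> cells (Q W e n) k"
  by (simp add: cells_Q)

lemma cubical_Q: "cubical_set (Q W e n)"
  unfolding cubical_set_def
proof (intro conjI allI impI ballI)
  fix k l f assume f: "box k l f"
  show "act (Q W e n) k l f \<in> cells (Q W e n) l \<rightarrow> cells (Q W e n) k"
  proof
    fix s assume "s \<in> cells (Q W e n) l"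
    then obtain h where h: "box l n h" "s = quot_map W e n l h" by (auto simp: cells_Q)
    show "act (Q W e n) k l f s \<in> cells (Q W e n) k"
      unfolding h(2) act_Q[OF h(1) f] by (rule quot_map_in[OF box.comp[OF f h(1)]])
  qed
next
  fix k s assume "s \<in> cells (Q W e n) k"
  then show "act (Q W e n) k k (idm k) s = s"
    by (auto simp: cells_Q act_Q box.idm)
next
  fix k l p f g s assume fg: "box k l f" "box l p g" and "s \<in> cells (Q W e n) p"
  then obtain h where h: "box p n h" "s = quot_map W e n p h" by (auto simp: cells_Q)
  show "act (Q W e n) k p (compose (pts k) g f) s = act (Q W e n) k l f (act (Q W e n) l p g s)"
    unfolding h(2) act_Q[OF h(1) fg(2)] act_Q[OF h(1) box.comp[OF fg]]
      act_Q[OF box.comp[OF fg(2) h(1)] fg(1)] box_assoc[OF fg h(1)] ..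
qed

text \<open>
  The cubes \<open>\<box>^n \<rightarrow> X\<close> that factor through the quotient
  \<open>Q^n\<close>.
\<close>

definition compat :: "side \<Rightarrow> bool \<Rightarrow> 'a cset \<Rightarrow> nat \<Rightarrow> 'a set" where
  "compat W e X n = {s \<in> cells X n. \<forall>k f g. box k n f \<longrightarrow> box k n g \<longrightarrow> sim W e k n f g \<longrightarrow>
     act X k n f s = act X k n g s}"

lemma compatD: "s \<in> compat W e X n \<Longrightarrow> box k n f \<Longrightarrow> box k n g \<Longrightarrow> sim W e k n f g \<Longrightarrow>
     act X k n f s = act X k n g s"
  unfolding compat_def by blast

text \<open>
  The cube of \<open>X\<close> underlying a map \<open>Q^n \<rightarrow> X\<close>, which is its
  composite with the quotient map from \<open>\<box>^n\<close>.
\<close>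

definition cube_of :: "side \<Rightarrow> bool \<Rightarrow> nat \<Rightarrow> (nat \<Rightarrow> cell \<Rightarrow> 'a) \<Rightarrow> 'a" where
  "cube_of W e n \<phi> = \<phi> n (quot_map W e n n (idm n))"

text \<open>The map \<open>Q^n \<rightarrow> X\<close> with a given underlying cube.\<close>

definition hom_of_cube :: "side \<Rightarrow> bool \<Rightarrow> 'a cset \<Rightarrow> nat \<Rightarrow> 'a \<Rightarrow> nat \<Rightarrow> cell \<Rightarrow> 'a" where
  "hom_of_cube W e X n s = (\<lambda>k. \<lambda>c\<in>cells (Q W e n) k.
     act X k n (SOME f. box k n f \<and> quot_map W e n k f = c) s)"

lemma hom_quot:
  assumes "\<phi> \<in> cset_hom (Q W e n) X" "box k n f"
  shows "\<phi> k (quot_map W e n k f) = act X k n f (cube_of W e n \<phi>)"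
proof -
  have "\<phi> k (act (Q W e n) k n f (quot_map W e n n (idm n))) = act X k n f (cube_of W e n \<phi>)"
    using assms quot_map_in[OF box.idm] unfolding cset_hom_def cube_of_def by blast
  then show ?thesis using assms(2) by (simp add: act_Q[OF box.idm])
qed

lemma cube_of_in_cells: "\<phi> \<in> cset_hom (Q W e n) X \<Longrightarrow> cube_of W e n \<phi> \<in> cells X n"
  using quot_map_in[OF box.idm, of W e n] by (auto simp: cube_of_def cset_hom_def PiE_iff)

lemma cube_of_compat: "\<phi> \<in> cset_hom (Q W e n) X \<Longrightarrow> cube_of W e n \<phi> \<in> compat W e X n"
  unfolding compat_def
proof (intro CollectI conjI allI impI)
  assume \<phi>: "\<phi> \<in> cset_hom (Q W e n) X"
  then show "cube_of W e n \<phi> \<in> cells X n" by (rule cube_of_in_cells)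
  fix k f g assume fg: "box k n f" "box k n g" and "sim W e k n f g"
  then have "quot_map W e n k f = quot_map W e n k g" using quot_map_eq_iff[OF fg] by blast
  then show "act X k n f (cube_of W e n \<phi>) = act X k n g (cube_of W e n \<phi>)"
    using hom_quot[OF \<phi> fg(1)] hom_quot[OF \<phi> fg(2)] by simp
qed

lemma cube_of_inj:
  assumes "\<phi> \<in> cset_hom (Q W e n) X" "\<psi> \<in> cset_hom (Q W e n) X" "cube_of W e n \<phi> = cube_of W e n \<psi>"
  shows "\<phi> = \<psi>"
proof
  fix k
  show "\<phi> k = \<psi> k"
  proof (rule PiE_ext)
    show "\<phi> k \<in> cells (Q W e n) k \<rightarrow>\<^sub>E cells X k" "\<psi> k \<in> cells (Q W e n) k \<rightarrow>\<^sub>E cells X k"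
      using assms(1,2) unfolding cset_hom_def by blast+
    fix c assume "c \<in> cells (Q W e n) k"
    then obtain f where f: "box k n f" "c = quot_map W e n k f" by (auto simp: cells_Q)
    show "\<phi> k c = \<psi> k c"
      unfolding f(2) hom_quot[OF assms(1) f(1)] hom_quot[OF assms(2) f(1)] assms(3) ..
  qed
qed

lemma hom_of_cube_quot:
  assumes "s \<in> compat W e X n" "box k n f"
  shows "hom_of_cube W e X n s k (quot_map W e n k f) = act X k n f s"
proof -
  let ?g = "SOME g. box k n g \<and> quot_map W e n k g = quot_map W e n k f"
  have g: "box k n ?g \<and> quot_map W e n k ?g = quot_map W e n k f"
    by (rule someI[of _ f]) (use assms(2) in simp)
  then have "sim W e k n ?g f" using quot_map_eq_iff assms(2) by blast
  with compatD[OF assms(1) _ assms(2)] g have "act X k n ?g s = act X k n f s" by blast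
  then show ?thesis using quot_map_in[OF assms(2)] by (simp add: hom_of_cube_def)
qed

lemma hom_of_cube_hom:
  assumes X: "cubical_set X" and s: "s \<in> compat W e X n"
  shows "hom_of_cube W e X n s \<in> cset_hom (Q W e n) X"
  unfolding cset_hom_def
proof (intro CollectI conjI allI impI ballI)
  have sX: "s \<in> cells X n" using s by (simp add: compat_def)
  fix k
  have "hom_of_cube W e X n s k c \<in> cells X k" if "c \<in> cells (Q W e n) k" for c
    using that sX by (auto simp: cells_Q hom_of_cube_quot[OF s] act_in[OF X])
  then show "hom_of_cube W e X n s k \<in> cells (Q W e n) k \<rightarrow>\<^sub>E cells X k"
    by (auto simp: PiE_iff) (auto simp: hom_of_cube_def)
  fix m f c assume f: "box m k f" and "c \<in> cells (Q W e n) k"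
  then obtain g where g: "box k n g" "c = quot_map W e n k g" by (auto simp: cells_Q)
  show "hom_of_cube W e X n s m (act (Q W e n) m k f c) = act X m k f (hom_of_cube W e X n s k c)"
    unfolding g(2) act_Q[OF g(1) f] hom_of_cube_quot[OF s g(1)] hom_of_cube_quot[OF s box.comp[OF f g(1)]]
    by (rule act_compose[OF X f g(1) sX])
qed

lemma cube_of_hom_of_cube:
  assumes "cubical_set X" "s \<in> compat W e X n"
  shows "cube_of W e n (hom_of_cube W e X n s) = s"
  unfolding cube_of_def hom_of_cube_quot[OF assms(2) box.idm]
  using act_idm[OF assms(1)] assms(2) by (auto simp: compat_def)

lemma hom_comp_in:
  assumes X: "cubical_set X" and "\<phi> \<in> cset_hom X Y" "\<psi> \<in> cset_hom Y Z"
  shows "hom_comp X \<psi> \<phi> \<in> cset_hom X Z"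
  using assms(2,3) act_in[OF X]
  by (auto simp: cset_hom_def hom_comp_def compose_def PiE_iff extensional_def Pi_iff)

lemma cube_of_hom_comp: "cube_of W e n (hom_comp (Q W e n) \<psi> \<phi>) = \<psi> n (cube_of W e n \<phi>)"
  using quot_map_in[OF box.idm, of W e n] by (simp add: cube_of_def hom_comp_def compose_def)

text \<open>The operators that descend to the quotients.\<close>

definition preserves :: "side \<Rightarrow> bool \<Rightarrow> nat \<Rightarrow> nat \<Rightarrow> oper \<Rightarrow> bool" where
  "preserves W e m n \<delta> \<longleftrightarrow> box m n \<delta> \<and> (\<forall>k f g. box k m f \<longrightarrow> box k m g \<longrightarrow> sim W e k m f g \<longrightarrow>
     sim W e k n (compose (pts k) \<delta> f) (compose (pts k) \<delta> g))"

text \<open>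
  The description of \<open>induced\<close> has a solution because the class of
  \<open>\<delta>\<close> is a compatible cube of \<open>Q^n\<close>, and only one because a map
  out of \<open>Q^m\<close> is determined by its underlying cube.
\<close>

lemma induced_hom:
  assumes "preserves W e m n \<delta>"
  shows "induced W e m n \<delta> \<in> cset_hom (Q W e m) (Q W e n)"
    and "cube_of W e m (induced W e m n \<delta>) = quot_map W e n m \<delta>"
proof -
  have d: "box m n \<delta>" using assms by (simp add: preserves_def)
  have compat: "quot_map W e n m \<delta> \<in> compat W e (Q W e n) m"
    unfolding compat_def
  proof (intro CollectI conjI allI impI)
    fix k f g assume *: "box k m f" "box k m g" "sim W e k m f g"
    then have "sim W e k n (compose (pts k) \<delta> f) (compose (pts k) \<delta> g)"
      using assms by (auto simp: preserves_def)
    with * show "act (Q W e n) k m f (quot_map W e n m \<delta>) = act (Q W e n) k m g (quot_map W e n m \<delta>)"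
      by (simp add: act_Q[OF d] quot_map_eq_iff box.comp[OF _ d])
  qed (use d quot_map_in in auto)
  let ?L = "hom_of_cube W e (Q W e n) m (quot_map W e n m \<delta>)"
  have L: "?L \<in> cset_hom (Q W e m) (Q W e n)" by (rule hom_of_cube_hom[OF cubical_Q compat])
  have Lq: "?L k (quot_map W e m k f) = quot_map W e n k (compose (pts k) \<delta> f)" if "box k m f" for k f
    using that by (simp add: hom_of_cube_quot[OF compat] act_Q[OF d])
  have "induced W e m n \<delta> = ?L"
    unfolding induced_def
  proof (rule the_equality)
    fix \<phi> assume \<phi>: "\<phi> \<in> cset_hom (Q W e m) (Q W e n) \<and>
     (\<forall>k f. box k m f \<longrightarrow> \<phi> k (quot_map W e m k f) = quot_map W e n k (compose (pts k) \<delta> f))"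
    then have "cube_of W e m \<phi> = quot_map W e n m \<delta>"
      unfolding cube_of_def using box.idm[of m] d by simp
    then show "\<phi> = ?L"
      using cube_of_inj[OF _ L, of \<phi>] \<phi> cube_of_hom_of_cube[OF cubical_Q compat] by simp
  qed (use L Lq in blast)
  then show "induced W e m n \<delta> \<in> cset_hom (Q W e m) (Q W e n)"
    "cube_of W e m (induced W e m n \<delta>) = quot_map W e n m \<delta>"
    using L cube_of_hom_of_cube[OF cubical_Q compat] by simp_all
qed

lemma hom_comp_induced:
  assumes d: "preserves W e m n \<delta>" and \<phi>: "\<phi> \<in> cset_hom (Q W e n) X"
  shows "hom_comp (Q W e m) \<phi> (induced W e m n \<delta>) \<in> cset_hom (Q W e m) X"
    and "cube_of W e m (hom_comp (Q W e m) \<phi> (induced W e m n \<delta>)) = act X m n \<delta> (cube_of W e n \<phi>)"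
  using hom_comp_in[OF cubical_Q induced_hom(1)[OF d] \<phi>]
    hom_quot[OF \<phi>] d by (auto simp: cube_of_hom_comp induced_hom(2)[OF d] preserves_def)

section \<open>Cofaces and codegeneracies in coordinates\<close>

text \<open>
  In ordered coordinates, cofaces insert a constant and codegeneracies either delete the oldest
  coordinate or merge two adjacent ones.
\<close>

definition ins :: "nat \<Rightarrow> bool \<Rightarrow> bool list \<Rightarrow> bool list" where
  "ins p b u = take p u @ b # drop p u"

definition mrg :: "bool \<Rightarrow> nat \<Rightarrow> bool list \<Rightarrow> bool list" where
  "mrg b p u = take p u @ (if b then u ! p \<and> u ! Suc p else u ! p \<or> u ! Suc p) # drop (Suc (Suc p)) u"

lemma length_ins [simp]: "length (ins p b u) = Suc (length u)"
  by (simp add: ins_def)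

lemma length_mrg [simp]: "Suc p < length u \<Longrightarrow> length (mrg b p u) = length u - 1"
  by (simp add: mrg_def)

lemma split_list2:
  assumes "p + q \<le> length u"
  shows "\<exists>x y z. u = x @ y @ z \<and> length x = p \<and> length y = q"
  using assms
  by (intro exI[of _ "take p u"] exI[of _ "take q (drop p u)"] exI[of _ "drop q (drop p u)"])
    (simp add: append_take_drop_id del: drop_drop)

lemma split_list_pair:
  assumes "Suc p < length u"
  shows "\<exists>x a b z. u = x @ a # b # z \<and> length x = p"
  using assms
  by (intro exI[of _ "take p u"] exI[of _ "u ! p"] exI[of _ "u ! Suc p"] exI[of _ "drop (Suc (Suc p)) u"])
    (simp add: Cons_nth_drop_Suc)

lemma ins_append [simp]: "length x = p \<Longrightarrow> ins p b (x @ y) = x @ b # y"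
  by (auto simp: ins_def)

lemma mrg_append [simp]:
  "length x = p \<Longrightarrow> mrg c p (x @ a # b # y) = x @ (if c then a \<and> b else a \<or> b) # y"
  by (auto simp: mrg_def nth_append)

lemma ins_ins:
  assumes "q \<le> p" "p \<le> length u"
  shows "ins q b (ins p c u) = ins (Suc p) c (ins q b u)"
proof -
  obtain x y z where u: "u = x @ y @ z" "length x = q" "length y = p - q"
    using split_list2[of q "p - q" u] assms by auto
  then show ?thesis
    using assms ins_append[of "x @ y" p c z] ins_append[of "x @ b # y" "Suc p" c z] by simp
qed

lemma mrg_ins_below:
  assumes "Suc q < p" "p \<le> length u"
  shows "mrg b q (ins p c u) = ins (p - 1) c (mrg b q u)"
proof -
  obtain x y z where u: "u = x @ y @ z" "length x = q" "length y = p - q"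
    using split_list2[of q "p - q" u] assms by auto
  then obtain a d w where y: "y = a # d # w"
    using assms by (cases y rule: remdups_adj.cases) auto
  show ?thesis
    using assms u y ins_append[of "x @ y" p c z]
      ins_append[of "x @ (if b then a \<and> d else a \<or> d) # w" "p - 1" c z] by simp
qed

lemma mrg_ins_above:
  assumes "q \<le> p" "Suc p < length u"
  shows "mrg b (Suc p) (ins q c u) = ins q c (mrg b p u)"
proof -
  obtain x a d z where u: "u = x @ a # d # z" "length x = p"
    using split_list_pair[OF assms(2)] by blast
  define y where "y = take q x"
  define w where "w = drop q x"
  have x: "x = y @ w" "length y = q" "length w = p - q"
    using assms u by (auto simp: y_def w_def)
  show ?thesis
    using assms u(2) mrg_append[of "y @ w" p b a d z] mrg_append[of "y @ c # w" "Suc p" b a d z]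
    by (simp add: u(1) x)
qed

lemma mrg_ins_same:
  assumes "p < length u"
  shows "mrg b p (ins (Suc p) b u) = u" "mrg b p (ins p b u) = u"
proof -
  obtain x a z where u: "u = x @ a # z" "length x = p"
    using assms id_take_nth_drop[OF assms] by (metis length_take min.absorb4)
  show "mrg b p (ins (Suc p) b u) = u" "mrg b p (ins p b u) = u"
    using u ins_append[of "x @ [a]" "Suc p" b z] by auto
qed

lemma mrg_mrg:
  assumes "q \<le> p" "Suc (Suc p) < length u"
  shows "mrg b q (mrg b (Suc p) u) = mrg b p (mrg b q u)"
proof (cases "q = p")
  case True
  obtain x a d z' where u: "u = x @ a # d # z'" "length x = q"
    using split_list_pair[of q u] assms by auto
  then obtain c z where "z' = c # z" using assms True by (cases z') auto
  then show ?thesis using u True mrg_append[of "x @ [a]" "Suc p" b d c z] by simp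
next
  case False
  obtain x a d z where u: "u = x @ a # d # z" "length x = Suc p"
    using split_list_pair[OF assms(2)] by blast
  obtain y a' d' w where x: "x = y @ a' # d' # w" "length y = q"
    using split_list_pair[of q x] False assms u by auto
  let ?m = "\<lambda>s t. if b then s \<and> t else s \<or> t"
  show ?thesis
    using u(2) x(2) mrg_append[of "y @ a' # d' # w" "Suc p" b a d z]
      mrg_append[of "y @ ?m a' d' # w" p b a d z]
    by (simp add: u(1) x(1))
qed

lemma butlast_mrg:
  assumes "Suc (Suc q) < length u"
  shows "mrg b q (butlast u) = butlast (mrg b q u)"
proof -
  obtain x a d z where u: "u = x @ a # d # z" "length x = q"
    using split_list_pair[of q u] assms by auto
  then have "z \<noteq> []" using assms by auto
  then show ?thesis using u by (simp add: butlast_append)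
qed

lemma butlast_mrg_last:
  assumes "length u = Suc (Suc n)"
  shows "butlast (mrg b n u) = butlast (butlast u)"
proof -
  obtain x a d z where u: "u = x @ a # d # z" "length x = n"
    using split_list_pair[of n u] assms by auto
  then show ?thesis using assms by (simp add: butlast_append)
qed

lemma butlast_ins:
  assumes "q < length u"
  shows "butlast (ins q b u) = ins q b (butlast u)"
  using assms by (cases u rule: rev_cases) (auto simp: ins_def butlast_append)

lemma ins_length [simp]: "length u = n \<Longrightarrow> ins n b u = u @ [b]"
  by (simp add: ins_def)

lemma mrg_snoc:
  assumes "Suc q < length u"
  shows "mrg b q (u @ [c]) = mrg b q u @ [c]"
proof -
  obtain x a d z where u: "u = x @ a # d # z" "length x = q"
    using split_list_pair[of q u] assms by auto
  then show ?thesis by simp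
qed

lemma mrg_snoc_last:
  assumes "length u = Suc q"
  shows "mrg (\<not> e) q (u @ [e]) = butlast u @ [e]"
  using assms by (cases u rule: rev_cases) auto

lemma co_cface_ins: "length u = n \<Longrightarrow> i \<le> n \<Longrightarrow> co W (cface W n i b) u = ins i b u"
  by (simp add: ins_def)

lemma co_cconn_mrg: "length u = Suc n \<Longrightarrow> i < n \<Longrightarrow> co W (cconn W n i b) u = mrg b i u"
  by (auto simp: mrg_def min_def max_def)

lemma co_cdegen_butlast: "length u = Suc n \<Longrightarrow> co W (cdegen W n n) u = butlast u"
  by (simp add: butlast_conv_take)

lemma coface_op_eq:
  "j \<le> Suc n \<Longrightarrow> coface_op W e n j = (if j = 0 then cface W n n e else cface W n (Suc n - j) (\<not> e))"
  by (cases W) (auto simp: cface_def Suc_diff_le)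

lemma codegen_op_eq:
  "j \<le> n \<Longrightarrow> codegen_op W e n j = (if j = 0 then cdegen W n n else cconn W n (n - j) (\<not> e))"
  by (cases W) (auto simp: cdegen_def cconn_def Suc_diff_le)

lemma box_coface_op: "j \<le> Suc n \<Longrightarrow> box n (Suc n) (coface_op W e n j)"
  by (auto simp: coface_op_eq box_cface)

lemma box_codegen_op: "j \<le> n \<Longrightarrow> box (Suc n) n (codegen_op W e n j)"
  by (auto simp: codegen_op_eq box_cdegen box_cconn)

lemma co_coface_op:
  "length u = n \<Longrightarrow> j \<le> Suc n \<Longrightarrow>
    co W (coface_op W e n j) u = (if j = 0 then u @ [e] else ins (Suc n - j) (\<not> e) u)"
  by (auto simp: coface_op_eq co_cface_ins simp del: co_cface)

lemma co_codegen_op: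
  "length u = Suc n \<Longrightarrow> j \<le> n \<Longrightarrow>
    co W (codegen_op W e n j) u = (if j = 0 then butlast u else mrg (\<not> e) (n - j) u)"
  by (auto simp: codegen_op_eq co_cconn_mrg co_cdegen_butlast simp del: co_cconn co_cdegen)

section \<open>Cosimplicial identities\<close>

text \<open>
  It suffices that \<open>\<delta>\<close> maps points that agree up to an
  \<open>\<epsilon>\<close> at position \<open>i\<close> to points that agree up to an
  \<open>\<epsilon>\<close> at some position \<open>i'\<close>. The value \<open>i' = n\<close>
  is past the end and stands for complete agreement.
\<close>

lemma preservesI:
  assumes "box m n \<delta>"
    and *: "\<And>i. i < m \<Longrightarrow> (\<exists>i'. i' \<le> n \<and> (\<forall>u w. length u = m \<longrightarrow> length w = m \<longrightarrow>
       take i u = take i w \<longrightarrow> u ! i = e \<longrightarrow> w ! i = e \<longrightarrow>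
       take i' (co W \<delta> u) = take i' (co W \<delta> w) \<and>
       (i' < n \<longrightarrow> co W \<delta> u ! i' = e \<and> co W \<delta> w ! i' = e)))"
  shows "preserves W e m n \<delta>"
  unfolding preserves_def
proof (intro conjI allI impI)
  fix k f g assume f: "box k m f" and g: "box k m g" and "sim W e k m f g"
  then consider "f = g" | i where "i < m" "\<And>u. length u = k \<Longrightarrow>
      take i (co W f u) = take i (co W g u) \<and> co W f u ! i = e \<and> co W g u ! i = e"
    unfolding sim_def by blast
  then show "sim W e k n (compose (pts k) \<delta> f) (compose (pts k) \<delta> g)"
  proof cases
    case 2
    from *[OF 2(1)] obtain i' where i': "i' \<le> n" "\<And>u w. length u = m \<Longrightarrow> length w = m \<Longrightarrow>
       take i u = take i w \<Longrightarrow> u ! i = e \<Longrightarrow> w ! i = e \<Longrightarrow>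
       take i' (co W \<delta> u) = take i' (co W \<delta> w) \<and>
       (i' < n \<longrightarrow> co W \<delta> u ! i' = e \<and> co W \<delta> w ! i' = e)" by blast
    have d: "take i' (co W \<delta> (co W f u)) = take i' (co W \<delta> (co W g u)) \<and>
       (i' < n \<longrightarrow> co W \<delta> (co W f u) ! i' = e \<and> co W \<delta> (co W g u) ! i' = e)" if u: "length u = k" for u
      using i'(2)[of "co W f u" "co W g u"] 2(2)[OF u] length_co[OF f u] length_co[OF g u] by blast
    show ?thesis
    proof (cases "i' < n")
      case True
      then show ?thesis unfolding sim_def using d by (intro disjI2 exI[of _ i']) simp
    next
      case False
      have "compose (pts k) \<delta> f = compose (pts k) \<delta> g"
      proof (rule box_ext_co[of k n _ _ W])
        fix u :: "bool list" assume u: "length u = k"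
        have "length (co W \<delta> (co W f u)) = n" "length (co W \<delta> (co W g u)) = n"
          using length_co[OF assms(1)] length_co[OF f u] length_co[OF g u] by auto
        then show "co W (compose (pts k) \<delta> f) u = co W (compose (pts k) \<delta> g) u"
          using d[OF u] False i'(1) u by simp
      qed (rule box.comp[OF f assms(1)], rule box.comp[OF g assms(1)])
      then show ?thesis by simp
    qed
  qed simp
qed (rule assms(1))

lemma take_ins_below: "i \<le> p \<Longrightarrow> p \<le> length u \<Longrightarrow> take i (ins p b u) = take i u"
  by (simp add: ins_def min_def)

lemma nth_ins_below: "i < p \<Longrightarrow> p \<le> length u \<Longrightarrow> ins p b u ! i = u ! i"
  by (simp add: ins_def nth_append)

lemma take_ins_above: "p \<le> i \<Longrightarrow> i \<le> length u \<Longrightarrow> take (Suc i) (ins p b u) = ins p b (take i u)"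
  by (simp add: ins_def min_def Suc_diff_le drop_take)

lemma nth_ins_above: "p \<le> i \<Longrightarrow> i < length u \<Longrightarrow> ins p b u ! Suc i = u ! i"
  by (simp add: ins_def nth_append Suc_diff_le min_def)

lemma take_mrg_below: "i \<le> p \<Longrightarrow> Suc p < length u \<Longrightarrow> take i (mrg b p u) = take i u"
  by (simp add: mrg_def min_def)

lemma nth_mrg_below: "i < p \<Longrightarrow> Suc p < length u \<Longrightarrow> mrg b p u ! i = u ! i"
  by (simp add: mrg_def nth_append)

lemma nth_mrg_at: "Suc p < length u \<Longrightarrow> mrg b p u ! p = (if b then u ! p \<and> u ! Suc p else u ! p \<or> u ! Suc p)"
  by (simp add: mrg_def nth_append)

lemma take_mrg_above:
  "Suc p < i \<Longrightarrow> i \<le> length u \<Longrightarrow> take (i - 1) (mrg b p u) = mrg b p (take i u)"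
  by (cases i) (auto simp: mrg_def min_def drop_take Suc_diff_Suc numeral_2_eq_2 take_Cons' )

lemma nth_mrg_above: "Suc p < i \<Longrightarrow> i < length u \<Longrightarrow> mrg b p u ! (i - 1) = u ! i"
  by (auto simp: mrg_def nth_append min_def nth_Cons' dest!: less_imp_Suc_add)

lemma preserves_coface_op:
  assumes j: "j \<le> Suc n"
  shows "preserves W e n (Suc n) (coface_op W e n j)"
proof (rule preservesI[OF box_coface_op[OF j]])
  fix i assume i: "i < n"
  show "\<exists>i'. i' \<le> Suc n \<and> (\<forall>u w. length u = n \<longrightarrow> length w = n \<longrightarrow>
       take i u = take i w \<longrightarrow> u ! i = e \<longrightarrow> w ! i = e \<longrightarrow>
       take i' (co W (coface_op W e n j) u) = take i' (co W (coface_op W e n j) w) \<and>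
       (i' < Suc n \<longrightarrow> co W (coface_op W e n j) u ! i' = e \<and> co W (coface_op W e n j) w ! i' = e))"
  proof (cases "j = 0 \<or> i < Suc n - j")
    case True
    have "take i (co W (coface_op W e n j) u) = take i u" "co W (coface_op W e n j) u ! i = u ! i"
      if "length u = n" for u
      using True i j that by (auto simp: co_coface_op nth_append take_ins_below nth_ins_below)
    with i show ?thesis by (intro exI[of _ i]) simp
  next
    case False
    have "take (Suc i) (co W (coface_op W e n j) u) = ins (Suc n - j) (\<not> e) (take i u)"
      "co W (coface_op W e n j) u ! Suc i = u ! i" if "length u = n" for u
      using False i j that by (auto simp: co_coface_op take_ins_above nth_ins_above)
    with i show ?thesis by (intro exI[of _ "Suc i"]) simp
  qed
qed

text \<open>
  The connections of sign \<open>1 - \<epsilon>\<close> have \<open>\<epsilon>\<close> as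
  absorbing element, so an \<open>\<epsilon>\<close> survives merging with either neighbour.
\<close>

lemma preserves_codegen_op:
  assumes j: "j \<le> n"
  shows "preserves W e (Suc n) n (codegen_op W e n j)"
proof (rule preservesI[OF box_codegen_op[OF j]])
  fix i assume i: "i < Suc n"
  show "\<exists>i'. i' \<le> n \<and> (\<forall>u w. length u = Suc n \<longrightarrow> length w = Suc n \<longrightarrow>
       take i u = take i w \<longrightarrow> u ! i = e \<longrightarrow> w ! i = e \<longrightarrow>
       take i' (co W (codegen_op W e n j) u) = take i' (co W (codegen_op W e n j) w) \<and>
       (i' < n \<longrightarrow> co W (codegen_op W e n j) u ! i' = e \<and> co W (codegen_op W e n j) w ! i' = e))"
  proof (cases "j = 0 \<or> i < n - j")
    case True
    have "take i (co W (codegen_op W e n j) u) = take i u"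
      "i < n \<Longrightarrow> co W (codegen_op W e n j) u ! i = u ! i"
      if "length u = Suc n" for u
      using True i j that by (auto simp: co_codegen_op butlast_conv_take take_mrg_below nth_mrg_below)
    with i show ?thesis by (intro exI[of _ i]) simp
  next
    case F: False
    show ?thesis
    proof (cases "i \<le> Suc (n - j)")
      case True
      have tk: "take (n - j) u = take (n - j) w" if "take i u = take i w" for u w :: "bool list"
        using arg_cong[OF that, of "take (n - j)"] F by (simp add: min_def split: if_splits)
      have i': "i = n - j \<or> i = Suc (n - j)" using True F by auto
      have m: "take (n - j) (co W (codegen_op W e n j) u) = take (n - j) u"
        "co W (codegen_op W e n j) u ! (n - j) =
           (if e then u ! (n - j) \<or> u ! Suc (n - j) else u ! (n - j) \<and> u ! Suc (n - j))"
        if "length u = Suc n" for u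
        using F j that by (simp_all add: co_codegen_op take_mrg_below nth_mrg_at)
      show ?thesis
      proof (intro exI[of _ "n - j"] conjI allI impI)
        fix u w :: "bool list"
        assume uw: "length u = Suc n" "length w = Suc n" "take i u = take i w" "u ! i = e" "w ! i = e"
        show "take (n - j) (co W (codegen_op W e n j) u) = take (n - j) (co W (codegen_op W e n j) w)"
          unfolding m(1)[OF uw(1)] m(1)[OF uw(2)] by (rule tk[OF uw(3)])
        show "co W (codegen_op W e n j) u ! (n - j) = e" "co W (codegen_op W e n j) w ! (n - j) = e"
          unfolding m(2)[OF uw(1)] m(2)[OF uw(2)] using i' uw(4,5) by auto
      qed simp
    next
      case False
      have "take (i - 1) (co W (codegen_op W e n j) u) = mrg (\<not> e) (n - j) (take i u)"
        "co W (codegen_op W e n j) u ! (i - 1) = u ! i" if "length u = Suc n" for u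
        using False F i j that take_mrg_above[of "n - j" i u] nth_mrg_above[of "n - j" i u]
        by (simp_all add: co_codegen_op)
      with i show ?thesis by (intro exI[of _ "i - 1"]) simp
    qed
  qed
qed

lemma sim_eqI:
  assumes "box k n f" "box k n g" "\<And>u. length u = k \<Longrightarrow> co W f u = co W g u"
  shows "sim W e k n f g"
  using box_ext_co[OF assms] by simp

text \<open>
  The only cosimplicial identity that needs the quotient: for \<open>i = 0\<close> and \<open>j
  = 1\<close> one composite appends \<open>\<epsilon>\<close> and \<open>1 - \<epsilon>\<close>,
  the other one appends \<open>\<epsilon>\<close> twice.
\<close>

lemma coface_coface:
  assumes "i < j" "j \<le> n + 2"
  shows "sim W e n (Suc (Suc n))
    (compose (pts n) (coface_op W e (Suc n) j) (coface_op W e n i))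
    (compose (pts n) (coface_op W e (Suc n) i) (coface_op W e n (j - 1)))"
proof (cases "i = 0 \<and> j = 1")
  case True
  then show ?thesis
    unfolding sim_def by (intro disjI2 exI[of _ n]) (auto simp: co_coface_op nth_append)
next
  case False
  show ?thesis
  proof (rule sim_eqI)
    show "box n (Suc (Suc n)) (compose (pts n) (coface_op W e (Suc n) j) (coface_op W e n i))"
      "box n (Suc (Suc n)) (compose (pts n) (coface_op W e (Suc n) i) (coface_op W e n (j - 1)))"
      using assms by (auto intro!: box.comp box_coface_op)
    fix u :: "bool list" assume u: "length u = n"
    show "co W (compose (pts n) (coface_op W e (Suc n) j) (coface_op W e n i)) u =
      co W (compose (pts n) (coface_op W e (Suc n) i) (coface_op W e n (j - 1))) u"
    proof (cases "i = 0")
      case True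
      with False assms u ins_ins[of "Suc (Suc n) - j" n u "\<not> e" e] show ?thesis
        by (auto simp: co_coface_op)
    next
      case i: False
      have "Suc (Suc n) - j \<le> Suc n - i" "Suc n - (j - 1) = Suc (Suc n) - j"
        "Suc (Suc n) - i = Suc (Suc n - i)" using assms i by auto
      with i assms u ins_ins[of "Suc (Suc n) - j" "Suc n - i" u "\<not> e" "\<not> e"] show ?thesis
        by (auto simp: co_coface_op)
    qed
  qed
qed

lemma codegen_codegen:
  assumes "i \<le> j" "j \<le> n"
  shows "sim W e (Suc (Suc n)) n
    (compose (pts (Suc (Suc n))) (codegen_op W e n j) (codegen_op W e (Suc n) i))
    (compose (pts (Suc (Suc n))) (codegen_op W e n i) (codegen_op W e (Suc n) (j + 1)))"
proof (rule sim_eqI)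
  show "box (Suc (Suc n)) n (compose (pts (Suc (Suc n))) (codegen_op W e n j) (codegen_op W e (Suc n) i))"
    "box (Suc (Suc n)) n (compose (pts (Suc (Suc n))) (codegen_op W e n i) (codegen_op W e (Suc n) (j + 1)))"
    using assms by (auto intro!: box.comp box_codegen_op)
  fix u :: "bool list" assume u: "length u = Suc (Suc n)"
  consider "i = 0" "j = 0" | "i = 0" "j > 0" | "i > 0" by auto
  then show "co W (compose (pts (Suc (Suc n))) (codegen_op W e n j) (codegen_op W e (Suc n) i)) u =
    co W (compose (pts (Suc (Suc n))) (codegen_op W e n i) (codegen_op W e (Suc n) (j + 1))) u"
  proof cases
    case 1
    with assms u butlast_mrg_last[OF u] show ?thesis by (simp add: co_codegen_op)
  next
    case 2
    with assms u butlast_mrg[of "n - j" u] show ?thesis by (simp add: co_codegen_op)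
  next
    case 3
    have "Suc n - i = Suc (n - i)" using 3 assms by auto
    with 3 assms u mrg_mrg[of "n - j" "n - i" u] show ?thesis by (simp add: co_codegen_op)
  qed
qed

lemma codegen_coface_less:
  assumes "i < j" "j \<le> n + 1"
  shows "sim W e (Suc n) (Suc n)
    (compose (pts (Suc n)) (codegen_op W e (Suc n) j) (coface_op W e (Suc n) i))
    (compose (pts (Suc n)) (coface_op W e n i) (codegen_op W e n (j - 1)))"
proof (rule sim_eqI)
  show "box (Suc n) (Suc n) (compose (pts (Suc n)) (codegen_op W e (Suc n) j) (coface_op W e (Suc n) i))"
    using assms by (auto intro!: box.comp[OF box_coface_op box_codegen_op])
  show "box (Suc n) (Suc n) (compose (pts (Suc n)) (coface_op W e n i) (codegen_op W e n (j - 1)))"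
    using assms by (auto intro!: box.comp[OF box_codegen_op box_coface_op])
  fix u :: "bool list" assume u: "length u = Suc n"
  consider "i = 0" "j = 1" | "i = 0" "j > 1" | "i > 0" using assms by linarith
  then show "co W (compose (pts (Suc n)) (codegen_op W e (Suc n) j) (coface_op W e (Suc n) i)) u =
    co W (compose (pts (Suc n)) (coface_op W e n i) (codegen_op W e n (j - 1))) u"
  proof cases
    case 1
    with assms u mrg_snoc_last[OF u] show ?thesis by (simp add: co_coface_op co_codegen_op)
  next
    case 2
    with assms u mrg_snoc[of "Suc n - j" u] show ?thesis
      by (simp add: co_coface_op co_codegen_op)
  next
    case 3
    have "n - (j - 1) = Suc n - j" "Suc (Suc n) - i - 1 = Suc n - i" using 3 assms by auto
    with 3 assms u mrg_ins_below[of "Suc n - j" "Suc (Suc n) - i" u] show ?thesis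
      by (simp add: co_coface_op co_codegen_op)
  qed
qed

lemma codegen_coface_same:
  assumes "j \<le> n" "i = j \<or> i = j + 1"
  shows "sim W e n n (compose (pts n) (codegen_op W e n j) (coface_op W e n i)) (idm n)"
proof (rule sim_eqI)
  show "box n n (compose (pts n) (codegen_op W e n j) (coface_op W e n i))"
    using assms by (auto intro!: box.comp[OF box_coface_op box_codegen_op])
  fix u :: "bool list" assume u: "length u = n"
  consider "i = 0" "j = 0" | "i = 1" "j = 0" | "j > 0" "i = j" | "j > 0" "i = j + 1"
    using assms by linarith
  then show "co W (compose (pts n) (codegen_op W e n j) (coface_op W e n i)) u = co W (idm n) u"
  proof cases
    case 3
    have "Suc n - j = Suc (n - j)" using assms by auto
    with 3 assms u mrg_ins_same[of "n - j" u "\<not> e"] show ?thesis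
      by (simp add: co_coface_op co_codegen_op)
  next
    case 4
    with assms u mrg_ins_same[of "n - j" u "\<not> e"] show ?thesis
      by (simp add: co_coface_op co_codegen_op)
  qed (use u in \<open>simp_all add: co_coface_op co_codegen_op\<close>)
qed (rule box.idm)

lemma codegen_coface_greater:
  assumes "j + 1 < i" "i \<le> n + 2"
  shows "sim W e (Suc n) (Suc n)
    (compose (pts (Suc n)) (codegen_op W e (Suc n) j) (coface_op W e (Suc n) i))
    (compose (pts (Suc n)) (coface_op W e n (i - 1)) (codegen_op W e n j))"
proof (rule sim_eqI)
  show "box (Suc n) (Suc n) (compose (pts (Suc n)) (codegen_op W e (Suc n) j) (coface_op W e (Suc n) i))"
    using assms by (auto intro!: box.comp[OF box_coface_op box_codegen_op])
  show "box (Suc n) (Suc n) (compose (pts (Suc n)) (coface_op W e n (i - 1)) (codegen_op W e n j))"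
    using assms by (auto intro!: box.comp[OF box_codegen_op box_coface_op])
  fix u :: "bool list" assume u: "length u = Suc n"
  have i: "Suc n - (i - 1) = Suc (Suc n) - i" using assms by auto
  show "co W (compose (pts (Suc n)) (codegen_op W e (Suc n) j) (coface_op W e (Suc n) i)) u =
    co W (compose (pts (Suc n)) (coface_op W e n (i - 1)) (codegen_op W e n j)) u"
  proof (cases "j = 0")
    case True
    with assms u i butlast_ins[of "Suc (Suc n) - i" u "\<not> e"] show ?thesis
      by (simp add: co_coface_op co_codegen_op)
  next
    case False
    have "Suc n - j = Suc (n - j)" using assms by auto
    with False assms u i mrg_ins_above[of "Suc (Suc n) - i" "n - j" u] show ?thesis
      by (simp add: co_coface_op co_codegen_op)
  qed
qed

section \<open>The simplicial set \<open>\<integral> X\<close>\<close>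

lemma simplices_integral [simp]: "simplices (integral W e X) n = cset_hom (Q W e n) X"
  by (simp add: integral_def)

lemma fc_integral:
  assumes "\<phi> \<in> cset_hom (Q W e (Suc n)) X" "j \<le> Suc n"
  shows "fc (integral W e X) n j \<phi> \<in> cset_hom (Q W e n) X"
    and "cube_of W e n (fc (integral W e X) n j \<phi>) = act X n (Suc n) (coface_op W e n j) (cube_of W e (Suc n) \<phi>)"
  using hom_comp_induced[OF preserves_coface_op[OF assms(2)] assms(1)]
  by (simp_all add: integral_def coface_def)

lemma dg_integral:
  assumes "\<phi> \<in> cset_hom (Q W e n) X" "j \<le> n"
  shows "dg (integral W e X) n j \<phi> \<in> cset_hom (Q W e (Suc n)) X"
    and "cube_of W e (Suc n) (dg (integral W e X) n j \<phi>) = act X (Suc n) n (codegen_op W e n j) (cube_of W e n \<phi>)"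
  using hom_comp_induced[OF preserves_codegen_op[OF assms(2)] assms(1)]
  by (simp_all add: integral_def codegen_def)

text \<open>
  The form in which an identity of operators modulo \<open>sim\<close> becomes a simplicial
  identity.
\<close>

lemma act_act_eq:
  assumes "cubical_set X" "s \<in> compat W e X p" "box m n f" "box n p g" "box m n' f'" "box n' p g'"
    "sim W e m p (compose (pts m) g f) (compose (pts m) g' f')"
  shows "act X m n f (act X n p g s) = act X m n' f' (act X n' p g' s)"
proof -
  have s: "s \<in> cells X p" using assms(2) by (simp add: compat_def)
  show ?thesis
    using compatD[OF assms(2) box.comp[OF assms(3,4)] box.comp[OF assms(5,6)] assms(7)]
    by (simp add: act_compose[OF assms(1,3,4) s] act_compose[OF assms(1,5,6) s])
qed

lemma simplicial_set_integral:
  assumes X: "cubical_set X"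
  shows "simplicial_set (integral W e X)"
  unfolding simplicial_set_def simplices_integral
proof (intro conjI allI impI ballI)
  fix n i assume i: "i \<le> Suc n"
  show "fc (integral W e X) n i \<in> cset_hom (Q W e (Suc n)) X \<rightarrow> cset_hom (Q W e n) X"
    using fc_integral(1)[OF _ i] by blast
next
  fix n i :: nat assume i: "i \<le> n"
  show "dg (integral W e X) n i \<in> cset_hom (Q W e n) X \<rightarrow> cset_hom (Q W e (Suc n)) X"
    using dg_integral(1)[OF _ i] by blast
next
  fix n i j and s :: "nat \<Rightarrow> cell \<Rightarrow> 'a"
  assume ij: "i < j" "j \<le> n + 2" and "s \<in> cset_hom (Q W e (n + 2)) X"
  then have s: "s \<in> cset_hom (Q W e (Suc (Suc n))) X" by simp
  have le: "i \<le> Suc (Suc n)" "j \<le> Suc (Suc n)" "i \<le> Suc n" "j - 1 \<le> Suc n" using ij by auto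
  have "act X n (Suc n) (coface_op W e n i)
        (act X (Suc n) (Suc (Suc n)) (coface_op W e (Suc n) j) (cube_of W e (Suc (Suc n)) s)) =
      act X n (Suc n) (coface_op W e n (j - 1))
        (act X (Suc n) (Suc (Suc n)) (coface_op W e (Suc n) i) (cube_of W e (Suc (Suc n)) s))"
    by (rule act_act_eq[OF X cube_of_compat[OF s]])
      (use coface_coface[OF ij] box_coface_op le in auto)
  then show "fc (integral W e X) n i (fc (integral W e X) (n + 1) j s) =
      fc (integral W e X) n (j - 1) (fc (integral W e X) (n + 1) i s)"
    unfolding Suc_eq_plus1[symmetric]
    by (intro cube_of_inj[OF fc_integral(1)[OF fc_integral(1)[OF s le(2)] le(3)]
        fc_integral(1)[OF fc_integral(1)[OF s le(1)] le(4)]])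
      (simp only: fc_integral(2)[OF fc_integral(1)[OF s le(2)] le(3)] fc_integral(2)[OF s le(2)]
        fc_integral(2)[OF fc_integral(1)[OF s le(1)] le(4)] fc_integral(2)[OF s le(1)])
next
  fix n i j and s :: "nat \<Rightarrow> cell \<Rightarrow> 'a"
  assume ij: "i \<le> j" "j \<le> n" and s: "s \<in> cset_hom (Q W e n) X"
  have le: "i \<le> n" "i \<le> Suc n" "Suc j \<le> Suc n" using ij by auto
  have "act X (Suc (Suc n)) (Suc n) (codegen_op W e (Suc n) i)
        (act X (Suc n) n (codegen_op W e n j) (cube_of W e n s)) =
      act X (Suc (Suc n)) (Suc n) (codegen_op W e (Suc n) (Suc j))
        (act X (Suc n) n (codegen_op W e n i) (cube_of W e n s))"
    by (rule act_act_eq[OF X cube_of_compat[OF s] box_codegen_op[OF le(2)] box_codegen_op[OF ij(2)]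
        box_codegen_op[OF le(3)] box_codegen_op[OF le(1)] codegen_codegen[OF ij, unfolded Suc_eq_plus1[symmetric]]])
  then show "dg (integral W e X) (n + 1) i (dg (integral W e X) n j s) =
      dg (integral W e X) (n + 1) (j + 1) (dg (integral W e X) n i s)"
    unfolding Suc_eq_plus1[symmetric]
    by (intro cube_of_inj[OF dg_integral(1)[OF dg_integral(1)[OF s ij(2)] le(2)]
        dg_integral(1)[OF dg_integral(1)[OF s le(1)] le(3)]])
      (simp only: dg_integral(2)[OF dg_integral(1)[OF s ij(2)] le(2)] dg_integral(2)[OF s ij(2)]
        dg_integral(2)[OF dg_integral(1)[OF s le(1)] le(3)] dg_integral(2)[OF s le(1)])
next
  fix n i j and s :: "nat \<Rightarrow> cell \<Rightarrow> 'a"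
  assume ij: "i < j" "j \<le> n + 1" and "s \<in> cset_hom (Q W e (n + 1)) X"
  then have s: "s \<in> cset_hom (Q W e (Suc n)) X" by simp
  have le: "i \<le> Suc (Suc n)" "j \<le> Suc n" "i \<le> Suc n" "j - 1 \<le> n" using ij by auto
  have "act X (Suc n) (Suc (Suc n)) (coface_op W e (Suc n) i)
        (act X (Suc (Suc n)) (Suc n) (codegen_op W e (Suc n) j) (cube_of W e (Suc n) s)) =
      act X (Suc n) n (codegen_op W e n (j - 1))
        (act X n (Suc n) (coface_op W e n i) (cube_of W e (Suc n) s))"
    by (rule act_act_eq[OF X cube_of_compat[OF s] box_coface_op[OF le(1)] box_codegen_op[OF le(2)]
        box_codegen_op[OF le(4)] box_coface_op[OF le(3)] codegen_coface_less[OF ij]])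
  then show "fc (integral W e X) (n + 1) i (dg (integral W e X) (n + 1) j s) =
      dg (integral W e X) n (j - 1) (fc (integral W e X) n i s)"
    unfolding Suc_eq_plus1[symmetric]
    by (intro cube_of_inj[OF fc_integral(1)[OF dg_integral(1)[OF s le(2)] le(1)]
        dg_integral(1)[OF fc_integral(1)[OF s le(3)] le(4)]])
      (simp only: fc_integral(2)[OF dg_integral(1)[OF s le(2)] le(1)] dg_integral(2)[OF s le(2)]
        dg_integral(2)[OF fc_integral(1)[OF s le(3)] le(4)] fc_integral(2)[OF s le(3)])
next
  fix n j :: nat and s :: "nat \<Rightarrow> cell \<Rightarrow> 'a"
  assume j: "j \<le> n" and s: "s \<in> cset_hom (Q W e n) X"
  have *: "fc (integral W e X) n i (dg (integral W e X) n j s) = s" if i: "i = j \<or> i = j + 1" for i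
  proof -
    have le: "i \<le> Suc n" using i j by auto
    have "act X n (Suc n) (coface_op W e n i) (act X (Suc n) n (codegen_op W e n j) (cube_of W e n s)) =
        act X n n (idm n) (act X n n (idm n) (cube_of W e n s))"
      by (rule act_act_eq[OF X cube_of_compat[OF s] box_coface_op[OF le] box_codegen_op[OF j] box.idm box.idm])
        (use codegen_coface_same[OF j i] box.idm in simp)
    also have "\<dots> = cube_of W e n s" by (simp add: act_idm[OF X cube_of_in_cells[OF s]])
    finally show ?thesis
      by (intro cube_of_inj[OF fc_integral(1)[OF dg_integral(1)[OF s j] le] s])
        (simp only: fc_integral(2)[OF dg_integral(1)[OF s j] le] dg_integral(2)[OF s j])
  qed
  show "fc (integral W e X) n j (dg (integral W e X) n j s) = s"
    "fc (integral W e X) n (j + 1) (dg (integral W e X) n j s) = s" by (simp_all add: *)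
next
  fix n i j and s :: "nat \<Rightarrow> cell \<Rightarrow> 'a"
  assume ij: "j + 1 < i" "i \<le> n + 2" and "s \<in> cset_hom (Q W e (n + 1)) X"
  then have s: "s \<in> cset_hom (Q W e (Suc n)) X" by simp
  have le: "i \<le> Suc (Suc n)" "j \<le> Suc n" "i - 1 \<le> Suc n" "j \<le> n" using ij by auto
  have "act X (Suc n) (Suc (Suc n)) (coface_op W e (Suc n) i)
        (act X (Suc (Suc n)) (Suc n) (codegen_op W e (Suc n) j) (cube_of W e (Suc n) s)) =
      act X (Suc n) n (codegen_op W e n j)
        (act X n (Suc n) (coface_op W e n (i - 1)) (cube_of W e (Suc n) s))"
    by (rule act_act_eq[OF X cube_of_compat[OF s] box_coface_op[OF le(1)] box_codegen_op[OF le(2)]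
        box_codegen_op[OF le(4)] box_coface_op[OF le(3)] codegen_coface_greater[OF ij]])
  then show "fc (integral W e X) (n + 1) i (dg (integral W e X) (n + 1) j s) =
      dg (integral W e X) n j (fc (integral W e X) n (i - 1) s)"
    unfolding Suc_eq_plus1[symmetric]
    by (intro cube_of_inj[OF fc_integral(1)[OF dg_integral(1)[OF s le(2)] le(1)]
        dg_integral(1)[OF fc_integral(1)[OF s le(3)] le(4)]])
      (simp only: fc_integral(2)[OF dg_integral(1)[OF s le(2)] le(1)] dg_integral(2)[OF s le(2)]
        dg_integral(2)[OF fc_integral(1)[OF s le(3)] le(4)] fc_integral(2)[OF s le(3)])
qed

section \<open>Constant simplices and last vertices\<close>

lemma act_const_cube:
  assumes "cubical_set X" "x \<in> cells X 0" "box m n h"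
  shows "act X m n h (const_cube X n x) = const_cube X m x"
proof -
  have "compose (pts m) (terminal n) h = terminal m"
    using box_0_eq_terminal box.comp[OF assms(3) box_terminal] by blast
  then show ?thesis
    using act_compose[OF assms(1,3) box_terminal assms(2)] by (simp add: const_cube_def)
qed

lemma const_cube_0: "cubical_set X \<Longrightarrow> x \<in> cells X 0 \<Longrightarrow> const_cube X 0 x = x"
  using box_0_eq_terminal[of 0 "idm 0"] box.idm[of 0] act_idm[of X x 0] by (simp add: const_cube_def)

lemma compat_0: "cubical_set X \<Longrightarrow> x \<in> cells X 0 \<Longrightarrow> x \<in> compat W e X 0"
  unfolding compat_def sim_def by blast

lemma integral_vertex:
  assumes "cubical_set X" "x \<in> cells X 0"
  shows "integral_vertex W e X x \<in> cset_hom (Q W e 0) X" "cube_of W e 0 (integral_vertex W e X x) = x"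
proof -
  let ?L = "hom_of_cube W e X 0 x"
  have L: "?L \<in> cset_hom (Q W e 0) X" "cube_of W e 0 ?L = x"
    by (rule hom_of_cube_hom[OF assms(1) compat_0[OF assms]], rule cube_of_hom_of_cube[OF assms(1) compat_0[OF assms]])
  have "integral_vertex W e X x = ?L"
    unfolding integral_vertex_def
  proof (rule the_equality)
    fix \<phi> assume "\<phi> \<in> cset_hom (Q W e 0) X \<and> \<phi> 0 (quot_map W e 0 0 (idm 0)) = x"
    then have "\<phi> \<in> cset_hom (Q W e 0) X" "cube_of W e 0 \<phi> = x" unfolding cube_of_def by blast+
    with cube_of_inj[OF _ L(1)] L(2) show "\<phi> = ?L" by simp
  qed (use L in \<open>simp only: cube_of_def simp_thms\<close>)
  then show "integral_vertex W e X x \<in> cset_hom (Q W e 0) X" "cube_of W e 0 (integral_vertex W e X x) = x"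
    using L by simp_all
qed

lemma const_simplex_integral:
  assumes X: "cubical_set X" and y: "y \<in> cset_hom (Q W e 0) X"
  shows "const_simplex (integral W e X) n y \<in> cset_hom (Q W e n) X \<and>
    cube_of W e n (const_simplex (integral W e X) n y) = const_cube X n (cube_of W e 0 y)"
proof (induction n)
  case 0
  then show ?case using y const_cube_0[OF X cube_of_in_cells[OF y]] by simp
next
  case (Suc n)
  then show ?case
    using dg_integral[of _ W e n X 0] act_const_cube[OF X cube_of_in_cells[OF y] box_codegen_op[of 0 n W e]]
    by simp
qed

text \<open>
  Each 0-th coface appends a coordinate \<open>\<epsilon>\<close>, so the last vertex is the
  value of the cube at \<open>(\<epsilon>, ..., \<epsilon>)\<close>.
\<close>

lemma last_vertex_integral:
  assumes X: "cubical_set X"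
  shows "\<phi> \<in> cset_hom (Q W e n) X \<Longrightarrow> last_vertex (integral W e X) n \<phi> \<in> cset_hom (Q W e 0) X \<and>
    cube_of W e 0 (last_vertex (integral W e X) n \<phi>) = act X 0 n (const_op 0 n e) (cube_of W e n \<phi>)"
proof (induction n arbitrary: \<phi>)
  case 0
  have "const_op 0 0 e = idm 0"
    by (rule box_ext_co[OF box_const_op box.idm, where W = SideL]) simp
  then show ?case using 0 act_idm[OF X cube_of_in_cells[OF 0]] by simp
next
  case (Suc n)
  have c: "compose (pts 0) (coface_op W e n 0) (const_op 0 n e) = const_op 0 (Suc n) e"
    by (rule box_ext_co[OF box.comp[OF box_const_op box_coface_op] box_const_op, where W = W])
      (simp_all add: co_coface_op replicate_append_same)
  have "fc (integral W e X) n 0 \<phi> \<in> cset_hom (Q W e n) X"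
    "cube_of W e n (fc (integral W e X) n 0 \<phi>) = act X n (Suc n) (coface_op W e n 0) (cube_of W e (Suc n) \<phi>)"
    using fc_integral[OF Suc.prems] by simp_all
  then show ?case
    using Suc.IH act_compose[OF X box_const_op[of 0 n e] box_coface_op[of 0 n W e] cube_of_in_cells[OF Suc.prems]] c
    by simp
qed

section \<open>Mapping spaces\<close>

lemma cells_map_space:
  "cells (map_space W X x0 x1) n = {s \<in> cells X (Suc n). \<forall>b.
     act X n (Suc n) (cface W n 0 b) s = const_cube X n (if b then x1 else x0)}"
  by (cases W) (auto simp: cface_def all_bool_eq)

lemma act_map_space:
  "act (map_space W X x0 x1) m n f s = act X (Suc m) (Suc n) (par W 1 m (idm 1) f) s"
  by (cases W) (auto simp: par_def)

lemma box_susp: "box m n f \<Longrightarrow> box (Suc m) (Suc n) (par W 1 m (idm 1) f)"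
  using box_par[OF box.idm[of 1], of m n f W] by simp

lemma susp_compose:
  assumes "box m n f" "box n p g"
  shows "par W 1 m (idm 1) (compose (pts m) g f) =
    compose (pts (Suc m)) (par W 1 n (idm 1) g) (par W 1 m (idm 1) f)"
  using par_compose[OF box.idm[of 1] assms(1) box.idm[of 1] assms(2), of W] box.idm[of 1] by simp

lemma susp_cface:
  assumes "box m n f"
  shows "compose (pts m) (par W 1 m (idm 1) f) (cface W m 0 b) = compose (pts m) (cface W n 0 b) f"
proof (rule box_ext_co[of m "Suc n" _ _ W])
  show "box m (Suc n) (compose (pts m) (par W 1 m (idm 1) f) (cface W m 0 b))"
    by (rule box.comp[OF box_cface box_susp[OF assms]]) simp
  show "box m (Suc n) (compose (pts m) (cface W n 0 b) f)"
    by (rule box.comp[OF assms box_cface]) simp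
qed (simp add: length_co[OF assms])

lemma cubical_map_space:
  assumes X: "cubical_set X" and x: "x0 \<in> cells X 0" "x1 \<in> cells X 0"
  shows "cubical_set (map_space W X x0 x1)"
  unfolding cubical_set_def act_map_space
proof (intro conjI allI impI ballI)
  let ?M = "map_space W X x0 x1"
  fix m n f assume f: "box m n f"
  show "act X (Suc m) (Suc n) (par W 1 m (idm 1) f) \<in> cells ?M n \<rightarrow> cells ?M m"
  proof
    fix s assume "s \<in> cells ?M n"
    then have s: "s \<in> cells X (Suc n)"
      "\<And>b. act X n (Suc n) (cface W n 0 b) s = const_cube X n (if b then x1 else x0)"
      unfolding cells_map_space by blast+
    have "act X m (Suc m) (cface W m 0 b) (act X (Suc m) (Suc n) (par W 1 m (idm 1) f) s) =
        const_cube X m (if b then x1 else x0)" for b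
    proof -
      have "act X m (Suc m) (cface W m 0 b) (act X (Suc m) (Suc n) (par W 1 m (idm 1) f) s) =
          act X m n f (act X n (Suc n) (cface W n 0 b) s)"
        using act_compose[OF X box_cface[of 0 m W b] box_susp[OF f, of W] s(1)]
          act_compose[OF X f box_cface[of 0 n W b] s(1)] susp_cface[OF f, of W b] by simp
      also have "\<dots> = const_cube X m (if b then x1 else x0)"
        unfolding s(2) by (rule act_const_cube[OF X _ f]) (use x in auto)
      finally show ?thesis .
    qed
    then show "act X (Suc m) (Suc n) (par W 1 m (idm 1) f) s \<in> cells ?M m"
      unfolding cells_map_space using act_in[OF X box_susp[OF f] s(1)] by blast
  qed
next
  fix n s assume "s \<in> cells (map_space W X x0 x1) n"
  then have "s \<in> cells X (Suc n)" unfolding cells_map_space by blast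
  then show "act X (Suc n) (Suc n) (par W 1 n (idm 1) (idm n)) s = s"
    using par_idm[of W 1 n] act_idm[OF X] by simp
next
  fix m n p f g s assume fg: "box m n f" "box n p g" and "s \<in> cells (map_space W X x0 x1) p"
  then have s: "s \<in> cells X (Suc p)" unfolding cells_map_space by blast
  show "act X (Suc m) (Suc p) (par W 1 m (idm 1) (compose (pts m) g f)) s =
    act X (Suc m) (Suc n) (par W 1 m (idm 1) f) (act X (Suc n) (Suc p) (par W 1 n (idm 1) g) s)"
    unfolding susp_compose[OF fg] by (rule act_compose[OF X box_susp[OF fg(1)] box_susp[OF fg(2)] s])
qed

text \<open>
  This contains the geometric content of the theorem: the left-hand side describes the simplices
  of \<open>\<integral> Map\<close>, the right-hand side those of \<open>Hom\<^sup>R\<close>. A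
  cube of the mapping space is constant on its face at \<open>\<epsilon>\<close> of the newest
  coordinate, which is the part of compatibility in \<open>X\<close> that compatibility in the
  mapping space does not cover. Conversely, compatibility in \<open>X\<close> forces this face
  to be constant, with value the last vertex.
\<close>

lemma compat_map_space:
  assumes X: "cubical_set X" and x: "x0 \<in> cells X 0" "x1 \<in> cells X 0"
  shows "s \<in> compat W e (map_space W X x0 x1) n \<longleftrightarrow> s \<in> compat W e X (Suc n) \<and>
     act X n (Suc n) (cface W n 0 (\<not> e)) s = const_cube X n (if e then x0 else x1) \<and>
     act X 0 (Suc n) (const_op 0 (Suc n) e) s = (if e then x1 else x0)"
    (is "?M \<longleftrightarrow> ?A \<and> ?F \<and> ?V")
proof -
  let ?xe = "if e then x1 else x0"
  have xe: "?xe \<in> cells X 0" using x by simp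
  have last: "compose (pts 0) (cface W n 0 e) (const_op 0 n e) = const_op 0 (Suc n) e"
    by (rule box_ext_co[OF box.comp[OF box_const_op box_cface] box_const_op, where W = W]) simp_all
  show ?thesis
  proof
    assume M: ?M
    then have s: "s \<in> cells X (Suc n)" and
      F: "\<And>b. act X n (Suc n) (cface W n 0 b) s = const_cube X n (if b then x1 else x0)"
      unfolding compat_def cells_map_space by blast+
    have "act X k (Suc n) f s = act X k (Suc n) g s"
      if fg: "box k (Suc n) f" "box k (Suc n) g" "sim W e k (Suc n) f g" for k f g
    proof (rule sim_Suc_induct[OF fg(3,1,2)])
      fix k' f g H
      assume *: "box k' n f" "box k' n g" "sim W e k' n f g" "box k (Suc k') H"
      from compatD[OF M *(1-3)]
      have "act X (Suc k') (Suc n) (par W 1 k' (idm 1) f) s = act X (Suc k') (Suc n) (par W 1 k' (idm 1) g) s"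
        unfolding act_map_space .
      then show "act X k (Suc n) (compose (pts k) (par W 1 k' (idm 1) f) H) s =
        act X k (Suc n) (compose (pts k) (par W 1 k' (idm 1) g) H) s"
        by (simp only: act_compose[OF X *(4) box_susp[OF *(1)] s] act_compose[OF X *(4) box_susp[OF *(2)] s])
    next
      have *: "act X k (Suc n) h s = const_cube X k ?xe"
        if h: "box k (Suc n) h" and 0: "\<And>u. length u = k \<Longrightarrow> co W h u ! 0 = e" for h
      proof -
        have b: "box k n (compose (pts k) (cdegen W n 0) h)"
          by (rule box.comp[OF h box_cdegen]) simp
        have "compose (pts k) (cface W n 0 e) (compose (pts k) (cdegen W n 0) h) = h"
        proof (rule box_ext_co[OF box.comp[OF b box_cface] h, where W = W])
          fix u :: "bool list" assume u: "length u = k"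
          show "co W (compose (pts k) (cface W n 0 e) (compose (pts k) (cdegen W n 0) h)) u = co W h u"
            using 0[OF u] length_co[OF h u, of W] u by (cases "co W h u") simp_all
        qed simp
        with act_compose[OF X b box_cface s, of 0 W e]
        have "act X k (Suc n) h s =
            act X k n (compose (pts k) (cdegen W n 0) h) (act X n (Suc n) (cface W n 0 e) s)"
          by simp
        also have "\<dots> = const_cube X k ?xe"
          unfolding F by (rule act_const_cube[OF X xe b])
        finally show ?thesis .
      qed
      fix f g assume "box k (Suc n) f" "box k (Suc n) g"
        "\<And>u. length u = k \<Longrightarrow> co W f u ! 0 = e" "\<And>u. length u = k \<Longrightarrow> co W g u ! 0 = e"
      then show "act X k (Suc n) f s = act X k (Suc n) g s" by (simp only: *)
    qed
    then have ?A unfolding compat_def using s by blast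
    moreover have ?F using F[of "\<not> e"] by simp
    moreover have ?V
      using act_compose[OF X box_const_op[of 0 n e] box_cface[of 0 n W e] s] last F[of e]
        act_const_cube[OF X xe box_const_op[of 0 n e]] const_cube_0[OF X xe] by simp
    ultimately show "?A \<and> ?F \<and> ?V" by blast
  next
    assume R: "?A \<and> ?F \<and> ?V"
    then have A: ?A and F: ?F and V: ?V by blast+
    have s: "s \<in> cells X (Suc n)" using A by (simp add: compat_def)
    have bt: "box n (Suc n) (compose (pts n) (const_op 0 (Suc n) e) (terminal n))"
      by (rule box.comp[OF box_terminal box_const_op])
    have t: "co W (terminal n) u = []" if "length u = n" for u
      using length_co[OF box_terminal that, of W] by simp
    have "sim W e n (Suc n) (cface W n 0 e) (compose (pts n) (const_op 0 (Suc n) e) (terminal n))"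
      unfolding sim_def by (intro disjI2 exI[of _ 0]) (simp add: t)
    from compatD[OF A box_cface bt this]
    have Fe: "act X n (Suc n) (cface W n 0 e) s = const_cube X n ?xe"
      using act_compose[OF X box_terminal box_const_op s, of n e] V by (simp add: const_cube_def)
    have "act X n (Suc n) (cface W n 0 b) s = const_cube X n (if b then x1 else x0)" for b
      using F Fe by (cases "b = e") auto
    then have "s \<in> cells (map_space W X x0 x1) n" unfolding cells_map_space using s by blast
    moreover have "act X (Suc k) (Suc n) (par W 1 k (idm 1) f) s = act X (Suc k) (Suc n) (par W 1 k (idm 1) g) s"
      if fg: "box k n f" "box k n g" "sim W e k n f g" for k f g
      using compatD[OF A box_susp[OF fg(1), of W] box_susp[OF fg(2), of W]]
        sim_par[OF fg(3,1,2) box.idm[of 1]] by simp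
    ultimately show ?M
      by (simp only: compat_def act_map_space mem_Collect_eq) blast
  qed
qed

lemma map_space_map_hom:
  assumes X: "cubical_set X" and x: "x0 \<in> cells X 0" "x1 \<in> cells X 0" and f: "f \<in> cset_hom X Y"
  shows "map_space_map W X x0 x1 f \<in> cset_hom (map_space W X x0 x1) (map_space W Y (f 0 x0) (f 0 x1))"
proof -
  let ?M = "map_space W X x0 x1"
  have fin: "f n s \<in> cells Y n" if "s \<in> cells X n" for n s
    using f that by (auto simp: cset_hom_def)
  have fact: "f m (act X m n h s) = act Y m n h (f n s)" if "box m n h" "s \<in> cells X n" for m n h s
    using f that by (auto simp: cset_hom_def)
  have sX: "s \<in> cells X (Suc n)" if "s \<in> cells ?M n" for s n
    using that unfolding cells_map_space by blast
  have "f (Suc n) s \<in> cells (map_space W Y (f 0 x0) (f 0 x1)) n" if s: "s \<in> cells ?M n" for n s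
  proof -
    have "act Y n (Suc n) (cface W n 0 b) (f (Suc n) s) = const_cube Y n (if b then f 0 x1 else f 0 x0)" for b
    proof -
      have "act Y n (Suc n) (cface W n 0 b) (f (Suc n) s) = f n (act X n (Suc n) (cface W n 0 b) s)"
        by (rule fact[OF box_cface sX[OF s], symmetric]) simp
      also have "act X n (Suc n) (cface W n 0 b) s = const_cube X n (if b then x1 else x0)"
        using s unfolding cells_map_space by blast
      also have "f n \<dots> = const_cube Y n (f 0 (if b then x1 else x0))"
        unfolding const_cube_def by (rule fact[OF box_terminal]) (use x in auto)
      finally show ?thesis by simp
    qed
    then show ?thesis unfolding cells_map_space using fin[OF sX[OF s]] by blast
  qed
  moreover have "map_space_map W X x0 x1 f m (act ?M m n h s) =
      act (map_space W Y (f 0 x0) (f 0 x1)) m n h (map_space_map W X x0 x1 f n s)"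
    if h: "box m n h" and s: "s \<in> cells ?M n" for m n h s
    using act_in[OF cubical_map_space[OF X x] h s] fact[OF box_susp[OF h] sX[OF s], of W] s
    by (simp add: map_space_map_def act_map_space)
  ultimately show ?thesis
    unfolding cset_hom_def by (auto simp: map_space_map_def)
qed

section \<open>The isomorphism\<close>

lemma act_compat:
  assumes X: "cubical_set X" and s: "s \<in> compat W e X n" and d: "preserves W e m n \<delta>"
  shows "act X m n \<delta> s \<in> compat W e X m"
proof -
  have sX: "s \<in> cells X n" using s by (simp add: compat_def)
  have bd: "box m n \<delta>" using d by (simp add: preserves_def)
  have "act X k m f (act X m n \<delta> s) = act X k m g (act X m n \<delta> s)"
    if fg: "box k m f" "box k m g" "sim W e k m f g" for k f g
  proof -
    have "sim W e k n (compose (pts k) \<delta> f) (compose (pts k) \<delta> g)"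
      using d fg unfolding preserves_def by blast
    from act_act_eq[OF X s fg(1) bd fg(2) bd this] show ?thesis .
  qed
  then show ?thesis unfolding compat_def using act_in[OF X bd sX] by blast
qed

text \<open>
  The index \<open>j\<close> counts cofaces from the oldest coordinate, hence it does not change
  when a newest coordinate is added; the same holds for codegeneracies.
\<close>

lemma susp_coface_op:
  assumes "j \<le> Suc n"
  shows "par W 1 n (idm 1) (coface_op W e n j) = coface_op W e (Suc n) j"
proof (rule box_ext_co[OF box_susp[OF box_coface_op[OF assms]] box_coface_op, where W = W])
  fix u :: "bool list" assume "length u = Suc n"
  then obtain a v where "u = a # v" "length v = n" by (cases u) auto
  then show "co W (par W 1 n (idm 1) (coface_op W e n j)) u = co W (coface_op W e (Suc n) j) u"
    using assms by (simp add: co_coface_op ins_def Suc_diff_le)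
qed (use assms in simp)

lemma susp_codegen_op:
  assumes "j \<le> n"
  shows "par W 1 (Suc n) (idm 1) (codegen_op W e n j) = codegen_op W e (Suc n) j"
proof (rule box_ext_co[OF box_susp[OF box_codegen_op[OF assms]] box_codegen_op, where W = W])
  fix u :: "bool list" assume "length u = Suc (Suc n)"
  then obtain a v where "u = a # v" "length v = Suc n" by (cases u) auto
  then show "co W (par W 1 (Suc n) (idm 1) (codegen_op W e n j)) u = co W (codegen_op W e (Suc n) j) u"
    using assms by (auto simp add: co_codegen_op mrg_def Suc_diff_le)
qed (use assms in simp)

text \<open>
  The structure maps are those of \<open>Y\<close>, one level higher, so only closure is at
  stake. For \<open>\<integral> X\<close> it will be read off from the comparison with the
  mapping space.
\<close>

lemma simplicial_set_homR:
  assumes Y: "simplicial_set Y"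
    and fc: "\<And>n i s. i \<le> Suc n \<Longrightarrow> s \<in> simplices (homR Y y0 y1) (Suc n) \<Longrightarrow>
      fc (homR Y y0 y1) n i s \<in> simplices (homR Y y0 y1) n"
    and dg: "\<And>n i s. i \<le> n \<Longrightarrow> s \<in> simplices (homR Y y0 y1) n \<Longrightarrow>
      dg (homR Y y0 y1) n i s \<in> simplices (homR Y y0 y1) (Suc n)"
  shows "simplicial_set (homR Y y0 y1)"
proof -
  let ?Z = "homR Y y0 y1"
  have Z: "fc ?Z n i = fc Y (Suc n) i" "dg ?Z n i = dg Y (Suc n) i" for n i
    by (simp_all add: homR_def)
  have in_Y: "s \<in> simplices Y (Suc n)" if "s \<in> simplices ?Z n" for s n
    using that by (simp add: homR_def)
  show ?thesis
    unfolding simplicial_set_def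
  proof (intro conjI allI impI ballI)
    fix n i j s assume ij: "i < j" "j \<le> n + 2" and s: "s \<in> simplices ?Z (n + 2)"
    then show "fc ?Z n i (fc ?Z (n + 1) j s) = fc ?Z n (j - 1) (fc ?Z (n + 1) i s)"
      unfolding Z using Y in_Y[OF s] unfolding simplicial_set_def by simp
  next
    fix n i j s assume ij: "i \<le> j" "j \<le> n" and s: "s \<in> simplices ?Z n"
    then show "dg ?Z (n + 1) i (dg ?Z n j s) = dg ?Z (n + 1) (j + 1) (dg ?Z n i s)"
      unfolding Z using Y in_Y[OF s] unfolding simplicial_set_def by simp
  next
    fix n i j s assume ij: "i < j" "j \<le> n + 1" and s: "s \<in> simplices ?Z (n + 1)"
    then show "fc ?Z (n + 1) i (dg ?Z (n + 1) j s) = dg ?Z n (j - 1) (fc ?Z n i s)"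
      unfolding Z using Y in_Y[OF s] unfolding simplicial_set_def by simp
  next
    fix n j s assume j: "j \<le> n" and s: "s \<in> simplices ?Z n"
    then show "fc ?Z n j (dg ?Z n j s) = s" "fc ?Z n (j + 1) (dg ?Z n j s) = s"
      unfolding Z using Y in_Y[OF s] unfolding simplicial_set_def by simp_all
  next
    fix n i j s assume ij: "j + 1 < i" "i \<le> n + 2" and s: "s \<in> simplices ?Z (n + 1)"
    then show "fc ?Z (n + 1) i (dg ?Z (n + 1) j s) = dg ?Z n j (fc ?Z n (i - 1) s)"
      unfolding Z using Y in_Y[OF s] unfolding simplicial_set_def by simp
  qed (use fc dg in blast)+
qed

context
  fixes W :: side and e :: bool and X :: "'a cset" and x0 x1 :: 'a
  assumes X: "cubical_set X" and x: "x0 \<in> cells X 0" "x1 \<in> cells X 0"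
begin

abbreviation (input) "map_sp \<equiv> map_space W X x0 x1"

abbreviation (input) "hom_sp \<equiv> homR (integral W e X)
  (integral_vertex W e X (if e then x0 else x1)) (integral_vertex W e X (if e then x1 else x0))"

text \<open>
  Maps out of \<open>Q\<close> may be compared on their underlying cubes, which turns the two
  conditions of \<open>Hom\<^sup>R\<close> into those of \<open>compat_map_space\<close>.
\<close>

lemma simplices_hom_sp: "\<psi> \<in> simplices hom_sp n \<longleftrightarrow>
  \<psi> \<in> cset_hom (Q W e (Suc n)) X \<and> cube_of W e (Suc n) \<psi> \<in> compat W e map_sp n"
proof (cases "\<psi> \<in> cset_hom (Q W e (Suc n)) X")
  case True
  let ?a = "if e then x0 else x1" and ?b = "if e then x1 else x0"
  have v: "?a \<in> cells X 0" "?b \<in> cells X 0" using x by auto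
  note iv = integral_vertex[OF X v(1), of W e] integral_vertex[OF X v(2), of W e]
  note c = const_simplex_integral[OF X iv(1), of n]
  note l = last_vertex_integral[OF X True]
  note f = fc_integral[OF True, of "Suc n"]
  have cf: "coface_op W e n (Suc n) = cface W n 0 (\<not> e)" by (simp add: coface_op_eq)
  have cube_of_eq: "\<phi> = \<phi>' \<longleftrightarrow> cube_of W e k \<phi> = cube_of W e k \<phi>'"
    if "\<phi> \<in> cset_hom (Q W e k) X" "\<phi>' \<in> cset_hom (Q W e k) X" for k \<phi> \<phi>'
    using cube_of_inj[OF that] by blast
  have "fc (integral W e X) n (Suc n) \<psi> = const_simplex (integral W e X) n (integral_vertex W e X ?a) \<longleftrightarrow>
      act X n (Suc n) (cface W n 0 (\<not> e)) (cube_of W e (Suc n) \<psi>) = const_cube X n ?a"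
    unfolding cube_of_eq[OF f(1)[OF order_refl] c[THEN conjunct1]] f(2)[OF order_refl] c[THEN conjunct2] iv(2) cf ..
  moreover have "last_vertex (integral W e X) (Suc n) \<psi> = integral_vertex W e X ?b \<longleftrightarrow>
      act X 0 (Suc n) (const_op 0 (Suc n) e) (cube_of W e (Suc n) \<psi>) = ?b"
    unfolding cube_of_eq[OF l[THEN conjunct1] iv(3)] l[THEN conjunct2] iv(4) ..
  ultimately show ?thesis
    using True cube_of_compat[OF True] unfolding compat_map_space[OF X x]
    by (simp only: homR_def sset.simps simplices_integral mem_Collect_eq simp_thms)
next
  case False
  then show ?thesis by (simp add: homR_def)
qed

lemma hom_sp_ops: "fc hom_sp n i = fc (integral W e X) (Suc n) i" "dg hom_sp n i = dg (integral W e X) (Suc n) i"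
  by (simp_all add: homR_def)

lemma hom_sp_fc:
  assumes "i \<le> Suc n" "\<psi> \<in> simplices hom_sp (Suc n)"
  shows "fc hom_sp n i \<psi> \<in> simplices hom_sp n"
    and "cube_of W e (Suc n) (fc hom_sp n i \<psi>) =
      act map_sp n (Suc n) (coface_op W e n i) (cube_of W e (Suc (Suc n)) \<psi>)"
proof -
  have \<psi>: "\<psi> \<in> cset_hom (Q W e (Suc (Suc n))) X" "cube_of W e (Suc (Suc n)) \<psi> \<in> compat W e map_sp (Suc n)"
    using assms(2) simplices_hom_sp by blast+
  show *: "cube_of W e (Suc n) (fc hom_sp n i \<psi>) =
      act map_sp n (Suc n) (coface_op W e n i) (cube_of W e (Suc (Suc n)) \<psi>)"
    using fc_integral(2)[OF \<psi>(1), of i] assms(1)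
    by (simp only: hom_sp_ops act_map_space susp_coface_op[OF assms(1)] le_SucI)
  show "fc hom_sp n i \<psi> \<in> simplices hom_sp n"
    unfolding simplices_hom_sp * unfolding hom_sp_ops
    using fc_integral(1)[OF \<psi>(1), of i] assms(1)
      act_compat[OF cubical_map_space[OF X x] \<psi>(2) preserves_coface_op[OF assms(1)]] by simp
qed

lemma hom_sp_dg:
  assumes "i \<le> n" "\<psi> \<in> simplices hom_sp n"
  shows "dg hom_sp n i \<psi> \<in> simplices hom_sp (Suc n)"
    and "cube_of W e (Suc (Suc n)) (dg hom_sp n i \<psi>) =
      act map_sp (Suc n) n (codegen_op W e n i) (cube_of W e (Suc n) \<psi>)"
proof -
  have \<psi>: "\<psi> \<in> cset_hom (Q W e (Suc n)) X" "cube_of W e (Suc n) \<psi> \<in> compat W e map_sp n"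
    using assms(2) simplices_hom_sp by blast+
  show *: "cube_of W e (Suc (Suc n)) (dg hom_sp n i \<psi>) =
      act map_sp (Suc n) n (codegen_op W e n i) (cube_of W e (Suc n) \<psi>)"
    using dg_integral(2)[OF \<psi>(1), of i] assms(1)
    by (simp only: hom_sp_ops act_map_space susp_codegen_op[OF assms(1)] le_SucI)
  show "dg hom_sp n i \<psi> \<in> simplices hom_sp (Suc n)"
    unfolding simplices_hom_sp * unfolding hom_sp_ops
    using dg_integral(1)[OF \<psi>(1), of i] assms(1)
      act_compat[OF cubical_map_space[OF X x] \<psi>(2) preserves_codegen_op[OF assms(1)]] by simp
qed

text \<open>
  A simplex of \<open>\<integral> Map\<close> and its image in \<open>Hom\<^sup>R\<close> have
  the same underlying cube of \<open>X\<close>.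
\<close>

abbreviation (input) "same_cube n \<phi> \<equiv> hom_of_cube W e X (Suc n) (cube_of W e n \<phi>)"

lemma same_cube_simplex:
  assumes "\<phi> \<in> cset_hom (Q W e n) map_sp"
  shows "same_cube n \<phi> \<in> simplices hom_sp n" "cube_of W e (Suc n) (same_cube n \<phi>) = cube_of W e n \<phi>"
proof -
  have compat_cube: "cube_of W e n \<phi> \<in> compat W e map_sp n" by (rule cube_of_compat[OF assms])
  then have A: "cube_of W e n \<phi> \<in> compat W e X (Suc n)" using compat_map_space[OF X x] by blast
  show "cube_of W e (Suc n) (same_cube n \<phi>) = cube_of W e n \<phi>" by (rule cube_of_hom_of_cube[OF X A])
  then show "same_cube n \<phi> \<in> simplices hom_sp n"
    unfolding simplices_hom_sp using hom_of_cube_hom[OF X A] compat_cube by simp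
qed

lemma hom_sp_eqI:
  "\<psi> \<in> simplices hom_sp n \<Longrightarrow> \<psi>' \<in> simplices hom_sp n \<Longrightarrow>
    cube_of W e (Suc n) \<psi> = cube_of W e (Suc n) \<psi>' \<Longrightarrow> \<psi> = \<psi>'"
  using cube_of_inj simplices_hom_sp by blast

lemma sset_iso_same_cube: "sset_iso (integral W e map_sp) hom_sp same_cube"
  unfolding sset_iso_def simplices_integral
proof (intro conjI allI impI ballI)
  show "simplicial_set (integral W e map_sp)"
    by (rule simplicial_set_integral[OF cubical_map_space[OF X x]])
  show "simplicial_set hom_sp"
    by (rule simplicial_set_homR[OF simplicial_set_integral[OF X]]) (fact hom_sp_fc(1), fact hom_sp_dg(1))
  fix n
  show "bij_betw (same_cube n) (cset_hom (Q W e n) map_sp) (simplices hom_sp n)"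
  proof (rule bij_betw_byWitness[where f' = "\<lambda>\<psi>. hom_of_cube W e map_sp n (cube_of W e (Suc n) \<psi>)"])
    have L: "hom_of_cube W e map_sp n (cube_of W e (Suc n) \<psi>) \<in> cset_hom (Q W e n) map_sp"
      "cube_of W e n (hom_of_cube W e map_sp n (cube_of W e (Suc n) \<psi>)) = cube_of W e (Suc n) \<psi>"
      if "\<psi> \<in> simplices hom_sp n" for \<psi>
      using that hom_of_cube_hom[OF cubical_map_space[OF X x]]
        cube_of_hom_of_cube[OF cubical_map_space[OF X x]]
      unfolding simplices_hom_sp by blast+
    show "\<forall>\<phi>\<in>cset_hom (Q W e n) map_sp. hom_of_cube W e map_sp n (cube_of W e (Suc n) (same_cube n \<phi>)) = \<phi>"
      using L same_cube_simplex cube_of_inj by metis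
    show "\<forall>\<psi>\<in>simplices hom_sp n. same_cube n (hom_of_cube W e map_sp n (cube_of W e (Suc n) \<psi>)) = \<psi>"
    proof
      fix \<psi> assume \<psi>: "\<psi> \<in> simplices hom_sp n"
      show "same_cube n (hom_of_cube W e map_sp n (cube_of W e (Suc n) \<psi>)) = \<psi>"
        by (rule hom_sp_eqI[OF same_cube_simplex(1)[OF L(1)[OF \<psi>]] \<psi>])
          (rule trans[OF same_cube_simplex(2)[OF L(1)[OF \<psi>]] L(2)[OF \<psi>]])
    qed
  qed (use same_cube_simplex hom_of_cube_hom[OF cubical_map_space[OF X x]] simplices_hom_sp in blast)+
next
  fix n i \<phi> assume i: "i \<le> Suc n" and \<phi>: "\<phi> \<in> cset_hom (Q W e (Suc n)) map_sp"
  note f = fc_integral[OF \<phi> i]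
  show "same_cube n (fc (integral W e map_sp) n i \<phi>) = fc hom_sp n i (same_cube (Suc n) \<phi>)"
    by (rule hom_sp_eqI[OF same_cube_simplex(1)[OF f(1)] hom_sp_fc(1)[OF i same_cube_simplex(1)[OF \<phi>]]])
      (rule trans[OF same_cube_simplex(2)[OF f(1)]],
        simp only: f(2) hom_sp_fc(2)[OF i same_cube_simplex(1)[OF \<phi>]] same_cube_simplex(2)[OF \<phi>])
next
  fix n i \<phi> assume i: "i \<le> n" and \<phi>: "\<phi> \<in> cset_hom (Q W e n) map_sp"
  note d = dg_integral[OF \<phi> i]
  show "same_cube (Suc n) (dg (integral W e map_sp) n i \<phi>) = dg hom_sp n i (same_cube n \<phi>)"
    by (rule hom_sp_eqI[OF same_cube_simplex(1)[OF d(1)] hom_sp_dg(1)[OF i same_cube_simplex(1)[OF \<phi>]]])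
      (rule trans[OF same_cube_simplex(2)[OF d(1)]],
        simp only: d(2) hom_sp_dg(2)[OF i same_cube_simplex(1)[OF \<phi>]] same_cube_simplex(2)[OF \<phi>])
qed

end

lemma integral_map_space_iso_homR:
  "naturally_isomorphic
     (\<lambda>(X :: 'a cset) x0 x1. integral W e (map_space W X x0 x1))
     (\<lambda>X x0 x1 f. integral_map W e (map_space_map W X x0 x1 f))
     (\<lambda>X x0 x1. homR (integral W e X) (integral_vertex W e X (if e then x0 else x1))
        (integral_vertex W e X (if e then x1 else x0)))
     (\<lambda>X x0 x1 f. homR_map (integral_map W e f))"
  unfolding naturally_isomorphic_def
proof (intro exI[of _ "\<lambda>X x0 x1 n \<phi>. hom_of_cube W e X (Suc n) (cube_of W e n \<phi>)"] conjI allI impI ballI)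
  fix X :: "'a cset" and x0 x1
  assume "cubical_set X" "x0 \<in> cells X 0" "x1 \<in> cells X 0"
  then show "sset_iso (integral W e (map_space W X x0 x1))
      (homR (integral W e X) (integral_vertex W e X (if e then x0 else x1))
        (integral_vertex W e X (if e then x1 else x0)))
      (\<lambda>n \<phi>. hom_of_cube W e X (Suc n) (cube_of W e n \<phi>))"
    by (rule sset_iso_same_cube)
next
  fix X Y :: "'a cset" and x0 x1 f n s
  assume X: "cubical_set X" and Y: "cubical_set Y" and x: "x0 \<in> cells X 0" "x1 \<in> cells X 0"
    and f: "f \<in> cset_hom X Y" and "s \<in> simplices (integral W e (map_space W X x0 x1)) n"
  then have s: "s \<in> cset_hom (Q W e n) (map_space W X x0 x1)" by simp
  have fx: "f 0 x0 \<in> cells Y 0" "f 0 x1 \<in> cells Y 0" using f x by (auto simp: cset_hom_def)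
  let ?s' = "hom_comp (Q W e n) (map_space_map W X x0 x1 f) s"
  have s': "?s' \<in> cset_hom (Q W e n) (map_space W Y (f 0 x0) (f 0 x1))"
    by (rule hom_comp_in[OF cubical_Q s map_space_map_hom[OF X x f]])
  let ?L = "hom_of_cube W e X (Suc n) (cube_of W e n s)"
  have L: "?L \<in> cset_hom (Q W e (Suc n)) X" "cube_of W e (Suc n) ?L = cube_of W e n s"
    using same_cube_simplex[OF X x s] simplices_hom_sp[OF X x] by blast+
  have "hom_of_cube W e Y (Suc n) (cube_of W e n ?s') = hom_comp (Q W e (Suc n)) f ?L"
  proof (rule cube_of_inj)
    show "hom_of_cube W e Y (Suc n) (cube_of W e n ?s') \<in> cset_hom (Q W e (Suc n)) Y"
      using same_cube_simplex[OF Y fx s'] simplices_hom_sp[OF Y fx] by blast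
    show "hom_comp (Q W e (Suc n)) f ?L \<in> cset_hom (Q W e (Suc n)) Y"
      by (rule hom_comp_in[OF cubical_Q L(1) f])
    show "cube_of W e (Suc n) (hom_of_cube W e Y (Suc n) (cube_of W e n ?s')) = cube_of W e (Suc n) (hom_comp (Q W e (Suc n)) f ?L)"
      using same_cube_simplex(2)[OF Y fx s'] cube_of_in_cells[OF s] by (simp add: cube_of_hom_comp L(2) map_space_map_def)
  qed
  then show "hom_of_cube W e Y (Suc n) (cube_of W e n (integral_map W e (map_space_map W X x0 x1 f) n s)) =
      homR_map (integral_map W e f) n ?L"
    by (simp add: integral_map_def homR_map_def)
qed

theorem lemma7p23:
  shows
    "naturally_isomorphic
       (\<lambda>(X :: 'a cset) x0 x1. integral SideL False (map_space SideL X x0 x1))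
       (\<lambda>X x0 x1 f. integral_map SideL False (map_space_map SideL X x0 x1 f))
       (\<lambda>X x0 x1. homR (integral SideL False X)
          (integral_vertex SideL False X x1) (integral_vertex SideL False X x0))
       (\<lambda>X x0 x1 f. homR_map (integral_map SideL False f))
     \<and>
     naturally_isomorphic
       (\<lambda>(X :: 'a cset) x0 x1. integral SideL True (map_space SideL X x0 x1))
       (\<lambda>X x0 x1 f. integral_map SideL True (map_space_map SideL X x0 x1 f))
       (\<lambda>X x0 x1. homR (integral SideL True X)
          (integral_vertex SideL True X x0) (integral_vertex SideL True X x1))
       (\<lambda>X x0 x1 f. homR_map (integral_map SideL True f))
     \<and>
     naturally_isomorphic
       (\<lambda>(X :: 'a cset) x0 x1. integral SideR False (map_space SideR X x0 x1))
       (\<lambda>X x0 x1 f. integral_map SideR False (map_space_map SideR X x0 x1 f))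
       (\<lambda>X x0 x1. homR (integral SideR False X)
          (integral_vertex SideR False X x1) (integral_vertex SideR False X x0))
       (\<lambda>X x0 x1 f. homR_map (integral_map SideR False f))
     \<and>
     naturally_isomorphic
       (\<lambda>(X :: 'a cset) x0 x1. integral SideR True (map_space SideR X x0 x1))
       (\<lambda>X x0 x1 f. integral_map SideR True (map_space_map SideR X x0 x1 f))
       (\<lambda>X x0 x1. homR (integral SideR True X)
          (integral_vertex SideR True X x0) (integral_vertex SideR True X x1))
       (\<lambda>X x0 x1 f. homR_map (integral_map SideR True f))"
  using integral_map_space_iso_homR[where W = SideL and e = False and 'a = 'a]
    integral_map_space_iso_homR[where W = SideL and e = True and 'a = 'a]
    integral_map_space_iso_homR[where W = SideR and e = False and 'a = 'a]
    integral_map_space_iso_homR[where W = SideR and e = True and 'a = 'a]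
  by (simp only: if_True if_False simp_thms)

end
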